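(* Let $n\ge 2$, $\beta\ge 1$, and let $\Omega\subset\mathbb{R}^n$ be a $\beta$-John domain. Let $p\ge 1$ and $q>0$ be finite exponents. Given $s\in(0,1)$, $a\ge 0$ and $f\in C^\infty(\Omega)$, we have, for $y\in\Omega$, $$ |f(y)-\bar f|\le C\int_{|x-y|<C_1 d(x)}\frac{h(x)}{|x-y|^{n-s}}\,dx+C\left(\int_{|x-y|<C_2 d(x)^{1/\beta}}h(x)^p\,d(x)^{b-\frac{(n+a)p}{\beta q}}\,dx\right)^{1/p}, $$ where $$ b<sp-p+1-n+\frac{p-1}{\beta}+\frac{p(n+a)}{q\beta}\ \text{ if } p>1,\qquad b=s-n+\frac{n+a}{\beta q}\ \text{ if } p=1, $$ $\bar f$ is a constant, $$ h(x):=\left(\int_{|x-w|\le d(x)/2}\frac{|f(w)-f(x)|^p}{|w-x|^{n+sp}}\,dw\right)^{1/p}\quad\text{for } x\in\Omega, $$ $h\equiv0$ outside $\Omega$, and $C$, $C_1$ and $C_2$ are positive constants depending only on $n$ and $\Omega$.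
   Context: $d(x)=\mathrm{dist}(x,\partial\Omega)$ for $x\in\Omega$; since $h\equiv0$ outside $\Omega$, the integrals in $x$ are over points $x\in\Omega$ satisfying the indicated restriction. $\beta$-John domain ($\beta\ge 1$): it is assumed, without loss of generality, that $0\in\Omega$. A bounded domain $\Omega\subset\mathbb{R}^n$ is a $\beta$-John domain if there exist a family of rectifiable curves $\gamma(t,y)$, $0\le t\le 1$, $y\in\Omega$, and positive constants $\lambda,K,C_0$ such that: (1) $\gamma(0,y)=y$ and $\gamma(1,y)=0$; (2) $d(\gamma(t,y))\ge\lambda t^\beta$; (3) $|\dot\gamma(t,y)|\le K$, where the dot denotes the derivative in $t$; (4) for all $x,y\in\Omega$ and $r\le\frac12 d(x)$, $\ell(\gamma(y)\cap B(x,r))\le C_0 r$, where $\gamma(y)$ denotes the curve $\gamma(\cdot,y)$ joining $y$ with $0$ and $\ell$ denotes length.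
   Formalization: If p>1 and β>1, the constant C of the second term may depend on p, q, s, a, b (not on f or y): a C depending only on n and Ω fails on the cusp |x'|<x_1^β as b tends to its bound. The C of the first term, C_1 and C_2 depend only on n and Ω; for p=1 or β=1 both C agree. *)

theory Defs
  imports "HOL-Analysis.Analysis"
begin

abbreviation bdist :: "'a::euclidean_space set \<Rightarrow> 'a \<Rightarrow> real" where
  "bdist \<Omega> x \<equiv> infdist x (frontier \<Omega>)"

text \<open>Length of the part of the curve \<open>g\<close> traversed at the times in \<open>T\<close>: the supremum of the sums of
  chord lengths over finite families of non-overlapping compact intervals contained in \<open>T\<close>. For
  \<open>T = {0..1}\<close> this is the usual length; points covered several times count with multiplicity.\<close>

definition curve_length :: "(real \<Rightarrow> 'a::euclidean_space) \<Rightarrow> real set \<Rightarrow> ennreal" where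
  "curve_length g T =
     (SUP D \<in> {D. D division_of \<Union>D \<and> \<Union>D \<subseteq> T}. \<Sum>I\<in>D. ennreal (norm (g (Sup I) - g (Inf I))))"

definition rectifiable :: "(real \<Rightarrow> 'a::euclidean_space) \<Rightarrow> bool" where
  "rectifiable g \<longleftrightarrow> path g \<and> curve_length g {0..1} < \<infinity>"

text \<open>The derivative of a rectifiable curve exists almost everywhere. The last clause is absolute
  continuity, without which an almost everywhere bound on the derivative says nothing about the
  singular part of the curve. A curve that is differentiable at every time of \<open>{0..1}\<close> with speed at
  most \<open>K\<close> satisfies it by the fundamental theorem of calculus.\<close>

definition speed_le :: "real \<Rightarrow> (real \<Rightarrow> 'a::euclidean_space) \<Rightarrow> bool" where
  "speed_le K g \<longleftrightarrow>
     (\<exists>N. negligible N \<and>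
        (\<forall>t\<in>{0..1} - N. g differentiable (at t within {0..1}) \<and>
           norm (vector_derivative g (at t within {0..1})) \<le> K)) \<and>
     (\<forall>t\<in>{0..1}. ((\<lambda>u. vector_derivative g (at u within {0..1})) has_integral (g t - g 0)) {0..t})"

definition john_domain :: "real \<Rightarrow> 'a::euclidean_space set \<Rightarrow> bool" where
  "john_domain \<beta> \<Omega> \<longleftrightarrow>
     open \<Omega> \<and> connected \<Omega> \<and> bounded \<Omega> \<and> 0 \<in> \<Omega> \<and>
     (\<exists>(\<gamma> :: real \<Rightarrow> 'a \<Rightarrow> 'a) lam K C0. lam > 0 \<and> K > 0 \<and> C0 > 0 \<and>
        (\<forall>y\<in>\<Omega>. rectifiable (\<lambda>t. \<gamma> t y) \<and> (\<forall>t\<in>{0..1}. \<gamma> t y \<in> \<Omega>)) \<and>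
        (\<forall>y\<in>\<Omega>. \<gamma> 0 y = y \<and> \<gamma> 1 y = 0) \<and>
        (\<forall>y\<in>\<Omega>. \<forall>t\<in>{0..1}. bdist \<Omega> (\<gamma> t y) \<ge> lam * t powr \<beta>) \<and>
        (\<forall>y\<in>\<Omega>. speed_le K (\<lambda>t. \<gamma> t y)) \<and>
        (\<forall>x\<in>\<Omega>. \<forall>y\<in>\<Omega>. \<forall>r. 0 < r \<and> r \<le> bdist \<Omega> x / 2 \<longrightarrow>
           curve_length (\<lambda>t. \<gamma> t y) {t \<in> {0..1}. \<gamma> t y \<in> ball x r} \<le> ennreal (C0 * r)))"

text \<open>Intended for open sets \<open>S\<close>.\<close>

primrec Ck_on :: "nat \<Rightarrow> 'a::euclidean_space set \<Rightarrow> ('a \<Rightarrow> real) \<Rightarrow> bool" where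
  "Ck_on 0 S f \<longleftrightarrow> continuous_on S f"
| "Ck_on (Suc k) S f \<longleftrightarrow>
     (\<forall>x\<in>S. f differentiable (at x)) \<and> (\<forall>v. Ck_on k S (\<lambda>x. frechet_derivative f (at x) v))"

definition smooth_on :: "'a::euclidean_space set \<Rightarrow> ('a \<Rightarrow> real) \<Rightarrow> bool" where
  "smooth_on S f \<longleftrightarrow> (\<forall>k. Ck_on k S f)"

text \<open>Powers with a positive real exponent, \<open>\<infinity>\<close> being sent to \<open>\<infinity>\<close>.\<close>

definition enn_powr :: "ennreal \<Rightarrow> real \<Rightarrow> ennreal" where
  "enn_powr u r = (if u = \<infinity> then \<infinity> else ennreal (enn2real u powr r))"

text \<open>The integrand at \<open>w = x\<close> is \<open>0 / 0 = 0\<close>, on a null set.\<close>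

definition frac_h ::
  "'a::euclidean_space set \<Rightarrow> real \<Rightarrow> real \<Rightarrow> ('a \<Rightarrow> real) \<Rightarrow> 'a \<Rightarrow> ennreal" where
  "frac_h \<Omega> s p f x =
     (if x \<in> \<Omega> then
        enn_powr (\<integral>\<^sup>+ w \<in> cball x (bdist \<Omega> x / 2).
            ennreal (\<bar>f w - f x\<bar> powr p / norm (w - x) powr (real DIM('a) + s * p)) \<partial>lborel) (1 / p)
      else 0)"

end

theory Submission
  imports Defs
begin

text \<open>
  Write \<open>d(x)\<close> for the distance of \<open>x\<close> to the boundary. Two mean values of \<open>f\<close>, over sets \<open>A\<close> and
  \<open>B\<close> of diameter and volume comparable to \<open>R\<close> and \<open>R\<^sup>n\<close>, with \<open>B\<close> inside the balls over which \<open>h\<close> is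
  computed on \<open>A\<close>, differ by at most \<open>C R powr (s - n)\<close> times the integral of \<open>h\<close> over \<open>A\<close>
  (\<open>mean_on_step\<close>): for \<open>x\<close> in \<open>A\<close> the mean over \<open>B\<close> of \<open>\<bar>f(w) - f(x)\<bar>\<close> is controlled by its mean of
  order \<open>p\<close>, hence by \<open>R powr s * h(x)\<close>. The proof joins \<open>f(y)\<close> to a fixed mean by such steps.

  Near \<open>y\<close> the steps go through the dyadic annuli around \<open>y\<close>, whose means tend to \<open>f(y)\<close>. The annulus
  of radius \<open>R\<close> contributes at most a multiple of the part of the integral of \<open>h(x) / \<bar>x - y\<bar> powr (n - s)\<close> over that annulus,
  so together they give the first term of the bound (\<open>pointwise_minus_mean_on_ball\<close>).

  From there one follows the John curve of \<open>y\<close> to \<open>0\<close>, with balls of radius \<open>d(z i) / 8\<close> around points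
  \<open>z i\<close> of the curve; each new point is the first exit of the curve from the previous ball, until the curve
  no longer leaves it. A point \<open>x\<close> lies in boundedly many of these balls: each of them, except the last
  one, accounts for a piece of the curve, of length at least a fixed multiple of \<open>d(x)\<close>, inside the ball \<open>B(x, d(x) / 2)\<close>, and the length of the curve in there
  is at most \<open>C0 d(x) / 2\<close>. Summing the steps, the chain costs at most a constant times the integral of
  \<open>h(x) d(x) powr (s - n)\<close> over the union \<open>E\<close> of the balls (\<open>whitney_chain_mean_difference\<close>). Since the
  curve has speed at most \<open>K\<close> and \<open>d \<ge> \<lambda> t powr \<beta>\<close> at time \<open>t\<close>, the points of \<open>E\<close> satisfy
  \<open>\<bar>x - y\<bar> < C2 d(x) powr (1 / \<beta>)\<close> (\<open>whitney_chain_region\<close>).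

  If \<open>p = 1\<close> this is literally the second term. If \<open>\<beta> = 1\<close>, then \<open>\<bar>x - y\<bar> < C2 d(x)\<close> on \<open>E\<close>, and the
  integral is absorbed by the first term. In these two cases no constant depends on \<open>p\<close>, \<open>s\<close> or
  the other exponents. Otherwise Hoelder's inequality splits off the second term and leaves the
  integral over \<open>E\<close> of a power \<open>d powr k\<close>, where the bound on \<open>b\<close> says exactly that
  \<open>k > 1 - n - 1 / \<beta>\<close>. This integral is at most a multiple of the sum of the \<open>d(z i) powr (k + n)\<close>, which is
  bounded independently of \<open>y\<close>: because \<open>d(z i)\<close> is at most a multiple of the time spent on the \<open>i\<close>-th piece and at
  least a multiple of \<open>t powr \<beta>\<close>, the sum without its last term is dominated, up to a constant, by the integral of \<open>t powr (\<epsilon> * \<beta> - 1)\<close> over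
  \<open>[0, 1]\<close> for some \<open>\<epsilon> > 0\<close> (\<open>whitney_chain_weight_bound\<close>).
\<close>

section \<open>A weak form of the Hoelder inequality\<close>

lemma enn_powr_ennreal: "0 \<le> c \<Longrightarrow> enn_powr (ennreal c) r = ennreal (c powr r)"
  by (simp add: enn_powr_def)

lemma enn_powr_mono: "u \<le> v \<Longrightarrow> 0 \<le> r \<Longrightarrow> enn_powr u r \<le> enn_powr v r"
  by (cases u; cases v) (auto simp: enn_powr_def powr_mono2 top_unique ennreal_leI)

lemma enn_powr_one: "enn_powr u 1 = u"
  by (cases u) (auto simp: enn_powr_def)

lemma enn_powr_mult_ennreal:
  assumes "0 < c"
  shows "enn_powr (u * ennreal c) r = enn_powr u r * ennreal (c powr r)"
proof (cases u)
  case (real v)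
  have "enn_powr (ennreal v * ennreal c) r = enn_powr (ennreal (v * c)) r"
    using real assms by (simp add: ennreal_mult)
  also have "\<dots> = ennreal (v powr r) * ennreal (c powr r)"
    using real assms by (subst enn_powr_ennreal) (auto simp: powr_mult ennreal_mult)
  finally show ?thesis
    using real by (simp add: enn_powr_ennreal)
next
  case top
  with assms show ?thesis
    by (simp add: enn_powr_def ennreal_mult_eq_top_iff ennreal_top_mult)
qed

lemma measurable_enn_powr [measurable]:
  assumes [measurable]: "g \<in> borel_measurable M"
  shows "(\<lambda>x. enn_powr (g x) r) \<in> borel_measurable M"
  unfolding enn_powr_def by measurable

text \<open>Young's inequality in homogeneous form: one of the two terms on the right already suffices, according to
whether \<open>x\<close> lies below the threshold \<open>\<theta> * w powr (1 / p)\<close>. It holds for \<open>p = 1\<close> as well.\<close>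

lemma young_threshold:
  fixes x w \<theta> p :: real
  assumes "0 \<le> x" "0 \<le> w" "0 < \<theta>" "1 \<le> p"
  shows "x * w powr (1 - 1 / p) \<le> \<theta> * w + \<theta> powr (1 - p) * x powr p"
proof (cases "x \<le> \<theta> * w powr (1 / p)")
  case True
  then have "x * w powr (1 - 1 / p) \<le> \<theta> * w powr (1 / p) * w powr (1 - 1 / p)"
    by (intro mult_right_mono) auto
  also have "\<dots> = \<theta> * w"
    using assms by (cases "w = 0") (auto simp flip: powr_add)
  finally show ?thesis
    using assms by (simp add: add_increasing2)
next
  case False
  then have "w powr (1 / p) \<le> x / \<theta>"
    using assms by (simp add: field_simps)
  then have "(w powr (1 / p)) powr (p - 1) \<le> (x / \<theta>) powr (p - 1)"
    using assms by (intro powr_mono2) auto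
  moreover have "(w powr (1 / p)) powr (p - 1) = w powr (1 - 1 / p)"
    using assms by (simp add: powr_powr field_simps)
  ultimately have "x * w powr (1 - 1 / p) \<le> x * (x / \<theta>) powr (p - 1)"
    using assms by (intro mult_left_mono) auto
  also have "\<dots> = \<theta> powr (1 - p) * x powr p"
  proof -
    have "0 < x"
      using False assms by (smt (verit) mult_nonneg_nonneg powr_ge_zero)
    have "\<theta> powr (1 - p) = 1 / \<theta> powr (p - 1)"
      using powr_minus_divide[of \<theta> "p - 1"] by simp
    moreover have "x powr p = x * x powr (p - 1)"
      using \<open>0 < x\<close> by (simp add: powr_mult_base)
    moreover have "(x / \<theta>) powr (p - 1) = x powr (p - 1) / \<theta> powr (p - 1)"
      by (rule powr_divide)
    ultimately show ?thesis by simp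
  qed
  finally show ?thesis
    using assms by (simp add: add_increasing)
qed

text \<open>Integrating \<open>young_threshold\<close> and choosing \<open>\<theta>\<close> just above the \<open>p\<close>-norm of \<open>X\<close> gives the Hoelder inequality
for \<open>X\<close> and a weight of mass at most \<open>A\<close>, with \<open>A + 1\<close> in place of \<open>A powr (1 - 1 / p)\<close>. What matters is
that the constant does not depend on \<open>p\<close>.\<close>

lemma weak_holder:
  assumes [measurable]: "X \<in> borel_measurable M" "w \<in> borel_measurable M"
    and w: "\<And>x. 0 \<le> w x" and A: "(\<integral>\<^sup>+x. ennreal (w x) \<partial>M) \<le> ennreal A" "0 \<le> A" and p: "1 \<le> p"
  shows "(\<integral>\<^sup>+x. X x * ennreal (w x powr (1 - 1 / p)) \<partial>M)
      \<le> ennreal (A + 1) * enn_powr (\<integral>\<^sup>+x. enn_powr (X x) p \<partial>M) (1 / p)"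
    (is "?L \<le> _ * enn_powr ?I _")
proof (cases ?I)
  case top
  then show ?thesis
    using A by (simp add: enn_powr_def ennreal_mult_eq_top_iff ennreal_mult_top)
next
  case (real I)
  have key: "?L \<le> ennreal ((A + 1) * \<theta>)" if \<theta>: "0 < \<theta>" "I \<le> \<theta> powr p" for \<theta>
  proof -
    have "?L \<le> (\<integral>\<^sup>+x. ennreal \<theta> * ennreal (w x) + ennreal (\<theta> powr (1 - p)) * enn_powr (X x) p \<partial>M)"
    proof (intro nn_integral_mono)
      fix x
      show "X x * ennreal (w x powr (1 - 1 / p))
          \<le> ennreal \<theta> * ennreal (w x) + ennreal (\<theta> powr (1 - p)) * enn_powr (X x) p"
      proof (cases "X x")
        case (real u)
        then show ?thesis
          using young_threshold[of u "w x" \<theta> p] w[of x] \<theta> p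
          by (simp add: enn_powr_ennreal ennreal_leI flip: ennreal_mult ennreal_plus)
      next
        case top
        then show ?thesis
          using \<theta> by (simp add: enn_powr_def ennreal_mult_top)
      qed
    qed
    also have "\<dots> = ennreal \<theta> * (\<integral>\<^sup>+x. ennreal (w x) \<partial>M) + ennreal (\<theta> powr (1 - p)) * ?I"
      by (simp add: nn_integral_add nn_integral_cmult)
    also have "\<dots> \<le> ennreal \<theta> * ennreal A + ennreal (\<theta> powr (1 - p)) * ennreal (\<theta> powr p)"
      unfolding real using A(1) \<theta> by (intro add_mono mult_left_mono ennreal_leI) auto
    also have "\<dots> = ennreal ((A + 1) * \<theta>)"
      using \<theta> A by (simp add: algebra_simps flip: ennreal_mult ennreal_plus powr_add)
    finally show ?thesis .
  qed
  have "?L \<le> ennreal (A + 1) * ennreal (I powr (1 / p))"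
  proof (rule ennreal_le_epsilon)
    fix e :: real assume e: "0 < e"
    \<comment> \<open>\<open>I\<close> may be \<open>0\<close>, so the \<open>p\<close>-norm itself is not an admissible
      threshold.\<close>
    define \<theta> where "\<theta> = I powr (1 / p) + e / (A + 1)"
    have pos: "0 < e / (A + 1)" using e A by simp
    have "(I powr (1 / p)) powr p \<le> \<theta> powr p"
      using pos p unfolding \<theta>_def by (intro powr_mono2) auto
    then have "I \<le> \<theta> powr p"
      using p real by (simp add: powr_powr)
    moreover have "0 < \<theta>" using pos by (simp add: \<theta>_def add_nonneg_pos)
    ultimately have "?L \<le> ennreal ((A + 1) * \<theta>)" by (rule key[rotated])
    also have "(A + 1) * \<theta> = (A + 1) * I powr (1 / p) + e"
      using A by (simp add: \<theta>_def field_simps)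
    finally show "?L \<le> ennreal (A + 1) * ennreal (I powr (1 / p)) + ennreal e"
      using A e by (simp add: ennreal_mult)
  qed
  then show ?thesis
    using real by (simp add: enn_powr_ennreal)
qed

section \<open>Differences of mean values\<close>

definition mean_on :: "'a::euclidean_space set \<Rightarrow> ('a \<Rightarrow> real) \<Rightarrow> real" where
  "mean_on A f = (LINT x:A|lborel. f x) / measure lborel A"

lemma mean_on_deviation:
  assumes int: "set_integrable lborel A f" and fin: "emeasure lborel A < \<infinity>"
    and [measurable]: "A \<in> sets borel" and pos: "0 < measure lborel A"
  shows "ennreal \<bar>mean_on A f - v\<bar> \<le> (\<integral>\<^sup>+x\<in>A. ennreal \<bar>f x - v\<bar> \<partial>lborel) / ennreal (measure lborel A)"
proof -
  have intc: "set_integrable lborel A (\<lambda>x. v)"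
    using fin by (simp add: set_integrable_def integrable_real_mult_indicator)
  have i: "set_integrable lborel A (\<lambda>x. f x - v)"
    using int intc by (rule set_integral_diff)
  have "mean_on A f - v = (LINT x:A|lborel. f x - v) / measure lborel A"
    using pos fin set_integral_diff(2)[OF int intc]
    by (simp add: mean_on_def field_simps set_lebesgue_integral_def)
  then have "ennreal \<bar>mean_on A f - v\<bar> = ennreal \<bar>LINT x:A|lborel. f x - v\<bar> / ennreal (measure lborel A)"
    using pos by (simp add: divide_ennreal)
  also have "ennreal \<bar>LINT x:A|lborel. f x - v\<bar> \<le> (\<integral>\<^sup>+x. ennreal (norm (indicator A x *\<^sub>R (f x - v))) \<partial>lborel)"
    unfolding set_lebesgue_integral_def real_norm_def[symmetric]
    by (rule integral_norm_bound_ennreal) (use i in \<open>simp add: set_integrable_def\<close>)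
  also have "\<dots> = (\<integral>\<^sup>+x\<in>A. ennreal \<bar>f x - v\<bar> \<partial>lborel)"
    by (intro nn_integral_cong) (auto simp: indicator_def)
  finally show ?thesis
    by (simp add: divide_right_mono_ennreal)
qed

lemma set_integrable_continuous_subset_compact:
  fixes f :: "'a::euclidean_space \<Rightarrow> real"
  assumes "continuous_on S f" "compact K" "K \<subseteq> S" "A \<subseteq> K" "A \<in> sets borel"
  shows "set_integrable lborel A f"
proof -
  have "set_integrable lborel K f"
    unfolding set_integrable_def
    using assms by (intro borel_integrable_compact continuous_on_subset[of S f K])
  then show ?thesis
    by (rule set_integrable_subset) (use assms in auto)
qed

text \<open>The mean of \<open>\<bar>f w - f x\<bar>\<close> over \<open>B\<close> is at most twice its mean of order \<open>p\<close>, and \<open>norm (w - x) \<le> R\<close> on \<open>B\<close> allows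
inserting the kernel of \<open>h\<close> at the cost of the factor \<open>R powr (n + s * p)\<close>. The factor \<open>\<kappa> powr (- 1 / p)\<close> left over
from the volume of \<open>B\<close> is bounded by \<open>max 1 (1 / \<kappa>)\<close>, uniformly in \<open>p\<close>.\<close>

lemma mean_oscillation_le_frac_h:
  fixes f :: "'a::euclidean_space \<Rightarrow> real"
  assumes f: "continuous_on \<Omega> f" and \<Omega>: "open \<Omega>" and x: "x \<in> \<Omega>"
    and B: "B \<subseteq> \<Omega>" "B \<in> sets borel" "B \<subseteq> cball x R" and R: "0 < R" "R \<le> bdist \<Omega> x / 2"
    and \<kappa>: "0 < \<kappa>" "\<kappa> * R ^ DIM('a) \<le> measure lborel B"
    and p: "1 \<le> p" and s: "0 < s"
  shows "(\<integral>\<^sup>+w\<in>B. ennreal \<bar>f w - f x\<bar> \<partial>lborel) / ennreal (measure lborel B)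
      \<le> ennreal (2 * max 1 (1 / \<kappa>) * R powr s) * frac_h \<Omega> s p f x"
proof -
  define n where "n = real DIM('a)"
  define m where "m = measure lborel B"
  have Rn: "R ^ DIM('a) = R powr n"
    using R by (simp add: n_def powr_realpow)
  have "0 < \<kappa> * R powr n" using \<kappa> R by simp
  then have m: "0 < m" "\<kappa> * R powr n \<le> m" using \<kappa> unfolding m_def Rn by linarith+
  have fin: "emeasure lborel B < \<infinity>"
    using B bounded_subset[OF bounded_cball] emeasure_bounded_finite by blast
  \<comment> \<open>Extending \<open>f\<close> by zero makes it Borel measurable on the whole space.\<close>
  define g where "g = (\<lambda>w. indicator \<Omega> w * f w)"
  have [measurable]: "g \<in> borel_measurable borel"
    using borel_measurable_continuous_on_indicator[OF _ f] \<Omega> by (simp add: g_def)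
  have [measurable]: "B \<in> sets borel" by fact
  define X where "X w = ennreal (\<bar>g w - g x\<bar> * m powr (- (1 / p)) * indicator B w)" for w
  define W where "W w = indicator B w / m" for w :: 'a
  have [measurable]: "X \<in> borel_measurable lborel" "W \<in> borel_measurable lborel"
    unfolding X_def[abs_def] W_def[abs_def] by measurable
  \<comment> \<open>With \<open>W\<close> of mass \<open>1\<close>, the product \<open>X * W powr (1 - 1 / p)\<close> is the
    integrand of the mean, and the \<open>p\<close>-norm of \<open>X\<close> the mean of order \<open>p\<close>.\<close>
  have W1: "(\<integral>\<^sup>+w. ennreal (W w) \<partial>lborel) \<le> ennreal 1"
  proof -
    have "(\<integral>\<^sup>+w. ennreal (W w) \<partial>lborel) = (\<integral>\<^sup>+w. ennreal (1 / m) * indicator B w \<partial>lborel)"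
      by (intro nn_integral_cong) (auto simp: W_def indicator_def)
    also have "\<dots> = ennreal (1 / m) * ennreal m"
      using fin by (simp add: nn_integral_cmult m_def emeasure_eq_ennreal_measure)
    finally show ?thesis using m by (simp flip: ennreal_mult)
  qed
  have "(\<integral>\<^sup>+w\<in>B. ennreal \<bar>f w - f x\<bar> \<partial>lborel) / ennreal m
      = (\<integral>\<^sup>+w. ennreal \<bar>f w - f x\<bar> * indicator B w / ennreal m \<partial>lborel)"
  proof (rule nn_integral_divide[symmetric])
    have "(\<lambda>w. ennreal \<bar>f w - f x\<bar> * indicator B w) = (\<lambda>w. ennreal \<bar>g w - g x\<bar> * indicator B w)"
      using B x by (intro ext) (auto simp: g_def indicator_def)
    then show "(\<lambda>w. ennreal \<bar>f w - f x\<bar> * indicator B w) \<in> borel_measurable lborel"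
      by simp
  qed
  also have "\<dots> = (\<integral>\<^sup>+w. X w * ennreal (W w powr (1 - 1 / p)) \<partial>lborel)"
  proof (intro nn_integral_cong)
    fix w
    have "m powr (- (1 / p)) * (1 / m) powr (1 - 1 / p) = 1 / m"
      using m by (simp add: powr_divide powr_diff powr_minus field_simps)
    then have "\<bar>f w - f x\<bar> * m powr (- (1 / p)) * (1 / m) powr (1 - 1 / p) = \<bar>f w - f x\<bar> / m"
      by (simp only: mult.assoc) simp
    then show "ennreal \<bar>f w - f x\<bar> * indicator B w / ennreal m = X w * ennreal (W w powr (1 - 1 / p))"
      using m B x by (auto simp: X_def W_def g_def divide_ennreal indicator_def simp flip: ennreal_mult)
  qed
  also have "\<dots> \<le> ennreal (1 + 1) * enn_powr (\<integral>\<^sup>+w. enn_powr (X w) p \<partial>lborel) (1 / p)"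
    by (rule weak_holder) (use m p W1 in \<open>auto simp: W_def\<close>)
  also have "enn_powr (\<integral>\<^sup>+w. enn_powr (X w) p \<partial>lborel) (1 / p)
      \<le> ennreal (max 1 (1 / \<kappa>) * R powr s) * frac_h \<Omega> s p f x"
  proof -
    define J where "J = (\<integral>\<^sup>+ w \<in> cball x (bdist \<Omega> x / 2).
            ennreal (\<bar>f w - f x\<bar> powr p / norm (w - x) powr (n + s * p)) \<partial>lborel)"
    define c where "c = max 1 (1 / \<kappa>) * R powr s"
    have c: "0 < c" using R by (simp add: c_def)
    have "1 / \<kappa> \<le> max 1 (1 / \<kappa>) powr p"
      using powr_mono[of 1 p "max 1 (1 / \<kappa>)"] p by (smt (verit) max.cobounded1 max.cobounded2 powr_one)
    then have cp: "R powr (n + s * p) / m \<le> c powr p"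
    proof -
      assume k: "1 / \<kappa> \<le> max 1 (1 / \<kappa>) powr p"
      have "R powr (n + s * p) / m \<le> R powr (n + s * p) / (\<kappa> * R powr n)"
        using m \<open>0 < \<kappa> * R powr n\<close> by (intro divide_left_mono) auto
      also have "\<dots> = 1 / \<kappa> * (R powr s) powr p"
        using R \<kappa> by (simp add: powr_add powr_powr)
      also have "\<dots> \<le> c powr p"
        unfolding c_def using R mult_right_mono[OF k, of "(R powr s) powr p"] by (subst powr_mult) auto
      finally show ?thesis .
    qed
    have "(\<integral>\<^sup>+w. enn_powr (X w) p \<partial>lborel)
      \<le> (\<integral>\<^sup>+w. ennreal (c powr p) * (ennreal (\<bar>g w - g x\<bar> powr p / norm (w - x) powr (n + s * p))
            * indicator B w) \<partial>lborel)"
    proof (intro nn_integral_mono)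
      fix w
      show "enn_powr (X w) p \<le> ennreal (c powr p) * (ennreal (\<bar>g w - g x\<bar> powr p / norm (w - x) powr (n + s * p))
            * indicator B w)"
      proof (cases "w \<in> B \<and> w \<noteq> x")
        case True
        then have wx: "0 < norm (w - x)" "norm (w - x) \<le> R"
          using B by (auto simp: dist_norm norm_minus_commute)
        have "(m powr (- (1 / p))) powr p = 1 / m"
          unfolding powr_powr using m p by (simp add: powr_minus_divide)
        then have "enn_powr (X w) p = ennreal (\<bar>g w - g x\<bar> powr p / m)"
          using True by (simp add: X_def enn_powr_ennreal powr_mult)
        also have "\<dots> \<le> ennreal (c powr p * (\<bar>g w - g x\<bar> powr p / norm (w - x) powr (n + s * p)))"
        proof (rule ennreal_leI)
          have "norm (w - x) powr (n + s * p) / m \<le> R powr (n + s * p) / m"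
            using wx m p s by (intro divide_right_mono powr_mono2) (auto simp: n_def)
          then have "norm (w - x) powr (n + s * p) / m \<le> c powr p" using cp by linarith
          then have "\<bar>g w - g x\<bar> powr p * (norm (w - x) powr (n + s * p) / m) \<le> \<bar>g w - g x\<bar> powr p * c powr p"
            by (intro mult_left_mono) auto
          then show "\<bar>g w - g x\<bar> powr p / m \<le> c powr p * (\<bar>g w - g x\<bar> powr p / norm (w - x) powr (n + s * p))"
            using wx m by (simp add: field_simps)
        qed
        finally show ?thesis
          using True by (subst (asm) ennreal_mult) auto
      next
        case False
        then show ?thesis
          using p by (auto simp: X_def enn_powr_def)
      qed
    qed
    also have "\<dots> = ennreal (c powr p) * (\<integral>\<^sup>+w\<in>B. ennreal (\<bar>g w - g x\<bar> powr p / norm (w - x) powr (n + s * p)) \<partial>lborel)"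
      by (rule nn_integral_cmult) measurable
    also have "\<dots> \<le> ennreal (c powr p) * J"
      unfolding J_def
    proof (intro mult_left_mono nn_integral_mono)
      fix w
      show "ennreal (\<bar>g w - g x\<bar> powr p / norm (w - x) powr (n + s * p)) * indicator B w
        \<le> ennreal (\<bar>f w - f x\<bar> powr p / norm (w - x) powr (n + s * p)) * indicator (cball x (bdist \<Omega> x / 2)) w"
        using B x R by (auto simp: g_def indicator_def)
    qed simp
    finally have "enn_powr (\<integral>\<^sup>+w. enn_powr (X w) p \<partial>lborel) (1 / p) \<le> enn_powr (J * ennreal (c powr p)) (1 / p)"
      using p by (intro enn_powr_mono) (auto simp: mult.commute)
    also have "\<dots> = frac_h \<Omega> s p f x * ennreal c"
      using c p x by (subst enn_powr_mult_ennreal) (auto simp: powr_powr frac_h_def J_def n_def)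
    finally show ?thesis by (simp add: c_def mult.commute)
  qed
  finally show ?thesis
    by (simp add: m_def mult.assoc ennreal_mult mult_left_mono)
qed

lemma borel_measurable_bdist [measurable]:
  "(\<lambda>x. bdist \<Omega> x) \<in> borel_measurable borel"
  by (intro borel_measurable_continuous_onI continuous_intros)

lemma borel_measurable_frac_h:
  fixes f :: "'a::euclidean_space \<Rightarrow> real"
  assumes f: "continuous_on \<Omega> f" and \<Omega>: "open \<Omega>"
    and sub: "\<And>x. x \<in> \<Omega> \<Longrightarrow> cball x (bdist \<Omega> x / 2) \<subseteq> \<Omega>"
  shows "frac_h \<Omega> s p f \<in> borel_measurable borel"
proof -
  define g where "g = (\<lambda>w. indicator \<Omega> w * f w)"
  have [measurable]: "g \<in> borel_measurable borel"
    using borel_measurable_continuous_on_indicator[OF _ f] \<Omega> by (simp add: g_def)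
  have [measurable]: "\<Omega> \<in> sets borel" using \<Omega> by simp
  define F where "F x = (if x \<in> \<Omega> then enn_powr (\<integral>\<^sup>+ w. (if dist x w \<le> bdist \<Omega> x / 2 then
            ennreal (\<bar>g w - g x\<bar> powr p / norm (w - x) powr (real DIM('a) + s * p)) else 0) \<partial>lborel) (1 / p)
      else 0)" for x :: 'a
  have "frac_h \<Omega> s p f = F"
  proof
    fix x
    show "frac_h \<Omega> s p f x = F x"
    proof (cases "x \<in> \<Omega>")
      case True
      have "(\<integral>\<^sup>+ w \<in> cball x (bdist \<Omega> x / 2).
            ennreal (\<bar>f w - f x\<bar> powr p / norm (w - x) powr (real DIM('a) + s * p)) \<partial>lborel)
         = (\<integral>\<^sup>+ w. (if dist x w \<le> bdist \<Omega> x / 2 then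
            ennreal (\<bar>g w - g x\<bar> powr p / norm (w - x) powr (real DIM('a) + s * p)) else 0) \<partial>lborel)"
        using sub[OF True] True by (intro nn_integral_cong) (auto simp: g_def indicator_def)
      with True show ?thesis by (simp add: frac_h_def F_def)
    qed (simp add: frac_h_def F_def)
  qed
  moreover have "F \<in> borel_measurable borel"
    unfolding F_def[abs_def] by measurable
  ultimately show ?thesis by simp
qed

text \<open>The basic step of every chain. The set \<open>A\<close> carries the integral of \<open>h\<close>, and \<open>B\<close> has to lie in the domain of
integration of \<open>h x\<close> for each \<open>x\<close> in \<open>A\<close>.\<close>

lemma mean_on_step:
  fixes f :: "'a::euclidean_space \<Rightarrow> real"
  assumes f: "continuous_on \<Omega> f" and \<Omega>: "open \<Omega>"
    and A: "A \<in> sets borel" "compact K" "A \<subseteq> K" "K \<subseteq> \<Omega>" and B: "B \<in> sets borel" "compact L" "B \<subseteq> L" "L \<subseteq> \<Omega>"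
    and near: "\<And>x. x \<in> A \<Longrightarrow> B \<subseteq> cball x R \<and> R \<le> bdist \<Omega> x / 2" and R: "0 < R"
    and \<kappa>: "0 < \<kappa>" "\<kappa> * R ^ DIM('a) \<le> measure lborel A" "\<kappa> * R ^ DIM('a) \<le> measure lborel B"
    and p: "1 \<le> p" and s: "0 < s" and h: "frac_h \<Omega> s p f \<in> borel_measurable borel"
  shows "ennreal \<bar>mean_on A f - mean_on B f\<bar>
      \<le> ennreal (2 * max 1 (1 / \<kappa>) / \<kappa> * R powr (s - real DIM('a))) * (\<integral>\<^sup>+x\<in>A. frac_h \<Omega> s p f x \<partial>lborel)"
proof -
  define c where "c = 2 * max 1 (1 / \<kappa>) * R powr s"
  have c: "0 \<le> c" by (simp add: c_def)
  have pos: "0 < \<kappa> * R ^ DIM('a)" using \<kappa> R by simp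
  have [measurable]: "A \<in> sets borel" "B \<in> sets borel" "frac_h \<Omega> s p f \<in> borel_measurable borel"
    by fact+
  have finA: "emeasure lborel A < \<infinity>" "emeasure lborel B < \<infinity>"
    using A B bounded_subset compact_imp_bounded emeasure_bounded_finite by blast+
  have "ennreal \<bar>mean_on A f - mean_on B f\<bar>
     \<le> (\<integral>\<^sup>+x\<in>A. ennreal \<bar>f x - mean_on B f\<bar> \<partial>lborel) / ennreal (measure lborel A)"
    using pos \<kappa> A f finA
    by (intro mean_on_deviation set_integrable_continuous_subset_compact[of \<Omega> f K]) auto
  also have "\<dots> \<le> (\<integral>\<^sup>+x\<in>A. ennreal c * frac_h \<Omega> s p f x \<partial>lborel) / ennreal (measure lborel A)"
  proof (intro divide_right_mono_ennreal nn_integral_mono)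
    fix x
    show "ennreal \<bar>f x - mean_on B f\<bar> * indicator A x \<le> ennreal c * frac_h \<Omega> s p f x * indicator A x"
    proof (cases "x \<in> A")
      case True
      have "ennreal \<bar>f x - mean_on B f\<bar> = ennreal \<bar>mean_on B f - f x\<bar>"
        by (simp add: abs_minus_commute)
      also have "\<dots> \<le> (\<integral>\<^sup>+w\<in>B. ennreal \<bar>f w - f x\<bar> \<partial>lborel) / ennreal (measure lborel B)"
        using pos \<kappa> B f finA
        by (intro mean_on_deviation set_integrable_continuous_subset_compact[of \<Omega> f L]) auto
      also have "\<dots> \<le> ennreal c * frac_h \<Omega> s p f x"
        unfolding c_def
        using near[OF True] A B True by (intro mean_oscillation_le_frac_h f \<Omega> \<kappa> p s R) auto
      finally show ?thesis using True by simp
    qed simp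
  qed
  also have "\<dots> = ennreal c * (\<integral>\<^sup>+x\<in>A. frac_h \<Omega> s p f x \<partial>lborel) / ennreal (measure lborel A)"
    by (simp add: mult.assoc nn_integral_cmult)
  also have "\<dots> \<le> ennreal c * (\<integral>\<^sup>+x\<in>A. frac_h \<Omega> s p f x \<partial>lborel) / ennreal (\<kappa> * R ^ DIM('a))"
    unfolding divide_ennreal_def using \<kappa> pos
    by (intro mult_left_mono) (auto simp: inverse_ennreal simp del: inverse_mult_distrib intro!: ennreal_leI le_imp_inverse_le)
  also have "\<dots> = ennreal (c / (\<kappa> * R ^ DIM('a))) * (\<integral>\<^sup>+x\<in>A. frac_h \<Omega> s p f x \<partial>lborel)"
    using c pos by (subst divide_ennreal[symmetric]) (auto simp: ennreal_divide_times ennreal_times_divide)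
  also have "c / (\<kappa> * R ^ DIM('a)) = 2 * max 1 (1 / \<kappa>) / \<kappa> * R powr (s - real DIM('a))"
    using R by (simp add: c_def powr_diff powr_realpow)
  finally show ?thesis .
qed

section \<open>From a point to a ball around it\<close>

lemma bdist_pos:
  fixes \<Omega> :: "'a::euclidean_space set"
  assumes "open \<Omega>" "bounded \<Omega>" "x \<in> \<Omega>"
  shows "0 < bdist \<Omega> x"
proof -
  have "frontier \<Omega> \<noteq> {}"
    using assms frontier_eq_empty[of \<Omega>] not_bounded_UNIV[where 'a = 'a] by auto
  moreover have "x \<notin> frontier \<Omega>"
    using assms by (simp add: frontier_def interior_open)
  ultimately show ?thesis
    by (simp add: infdist_pos_not_in_closed frontier_closed)
qed

lemma ball_bdist_subset:
  fixes \<Omega> :: "'a::euclidean_space set"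
  assumes "x \<in> \<Omega>"
  shows "ball x (bdist \<Omega> x) \<subseteq> \<Omega>"
proof
  fix w assume w: "w \<in> ball x (bdist \<Omega> x)"
  then have x: "x \<in> ball x (bdist \<Omega> x)"
    by (metis centre_in_ball dist_commute_lessI mem_ball zero_le_dist order_le_less_trans)
  show "w \<in> \<Omega>"
  proof (rule ccontr)
    assume "w \<notin> \<Omega>"
    then have "ball x (bdist \<Omega> x) \<inter> frontier \<Omega> \<noteq> {}"
      using w x assms by (intro connected_Int_frontier connected_ball) blast+
    then obtain v where "v \<in> frontier \<Omega>" "dist x v < bdist \<Omega> x" by auto
    then show False using infdist_le[of v "frontier \<Omega>" x] by simp
  qed
qed

lemma cball_half_bdist_subset:
  fixes \<Omega> :: "'a::euclidean_space set"
  assumes "open \<Omega>" "bounded \<Omega>" "x \<in> \<Omega>"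
  shows "cball x (bdist \<Omega> x / 2) \<subseteq> \<Omega>"
proof -
  have "cball x (bdist \<Omega> x / 2) \<subseteq> ball x (bdist \<Omega> x)"
    using bdist_pos[OF assms] by (auto simp: cball_subset_ball_iff)
  then show ?thesis using ball_bdist_subset[OF \<open>x \<in> \<Omega>\<close>] by blast
qed

text \<open>The distance to the boundary varies by at most an eighth on the balls of radius \<open>d(z) / 8\<close> used from now on,
which leaves room for neighbouring balls inside \<open>B(x, d(x) / 2)\<close>.\<close>

lemma bdist_ball_bounds:
  assumes "dist z x \<le> bdist \<Omega> z / 8"
  shows "bdist \<Omega> x \<le> 9 / 8 * bdist \<Omega> z" "7 / 8 * bdist \<Omega> z \<le> bdist \<Omega> x"
  using assms infdist_triangle[of x "frontier \<Omega>" z] infdist_triangle[of z "frontier \<Omega>" x]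
  by (simp_all add: dist_commute)

text \<open>The ratio \<open>\<kappa>\<close> of \<open>mean_on_step\<close> that is attained by each ball of radius at least \<open>R / 8\<close>, and the constant
that this step then has. They depend on the dimension only, hence the type argument.\<close>

definition ball_ratio :: "'a::euclidean_space itself \<Rightarrow> real" where
  "ball_ratio _ = unit_ball_vol (real DIM('a)) / 8 ^ DIM('a)"

definition step_const :: "'a::euclidean_space itself \<Rightarrow> real" where
  "step_const T = 2 * max 1 (1 / ball_ratio T) / ball_ratio T"

lemma ball_ratio_pos: "0 < ball_ratio T"
  by (simp add: ball_ratio_def)

lemma step_const_pos: "0 < step_const T"
  by (simp add: step_const_def ball_ratio_pos less_max_iff_disj)

lemma ball_ratio_le_measure_ball:
  fixes z :: "'a::euclidean_space"
  assumes "0 < R" "R / 8 \<le> r"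
  shows "ball_ratio TYPE('a) * R ^ DIM('a) \<le> measure lborel (ball z r)"
proof -
  have "ball_ratio TYPE('a) * R ^ DIM('a) = unit_ball_vol (real DIM('a)) * (R / 8) ^ DIM('a)"
    by (simp add: ball_ratio_def power_divide)
  also have "\<dots> \<le> unit_ball_vol (real DIM('a)) * r ^ DIM('a)"
    using assms by (intro mult_left_mono power_mono) auto
  also have "\<dots> = measure lborel (ball z r)"
    using assms by (simp add: content_ball)
  finally show ?thesis .
qed

lemma ball_ratio_le_measure_annulus:
  fixes z :: "'a::euclidean_space"
  assumes "0 < R" "R / 8 \<le> r / 2"
  shows "ball_ratio TYPE('a) * R ^ DIM('a) \<le> measure lborel (ball z r - ball z (r / 2))"
proof -
  have r: "0 < r" using assms by simp
  have "r ^ DIM('a) = 2 ^ DIM('a) * (r / 2) ^ DIM('a)"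
    by (simp add: power_divide)
  moreover have "(2::real) ^ 1 \<le> 2 ^ DIM('a)"
    by (intro power_increasing) (auto simp: DIM_positive Suc_leI)
  ultimately have "2 * (r / 2) ^ DIM('a) \<le> r ^ DIM('a)"
    using r by (metis power_one_right mult_right_mono zero_le_power half_gt_zero less_imp_le)
  then have *: "unit_ball_vol (real DIM('a)) * (r / 2) ^ DIM('a)
      \<le> unit_ball_vol (real DIM('a)) * (r ^ DIM('a) - (r / 2) ^ DIM('a))"
    by (intro mult_left_mono) auto
  have "measure lborel (ball z r - ball z (r / 2)) = measure lborel (ball z r) - measure lborel (ball z (r / 2))"
    using r emeasure_bounded_finite[OF bounded_ball, of z r]
    by (intro measure_Diff) (auto simp: ball_subset_ball_iff)
  also have "\<dots> = unit_ball_vol (real DIM('a)) * (r ^ DIM('a) - (r / 2) ^ DIM('a))"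
    using r by (simp add: content_ball algebra_simps)
  also have "\<dots> \<ge> measure lborel (ball z (r / 2))"
    using * r by (simp add: content_ball)
  finally have "measure lborel (ball z (r / 2)) \<le> measure lborel (ball z r - ball z (r / 2))" .
  then show ?thesis
    using ball_ratio_le_measure_ball[of R "r / 2" z] assms by linarith
qed

lemma mean_on_annulus_step:
  fixes f :: "'a::euclidean_space \<Rightarrow> real"
  assumes f: "continuous_on \<Omega> f" and \<Omega>: "open \<Omega>" "bounded \<Omega>" and y: "y \<in> \<Omega>"
    and p: "1 \<le> p" and s: "0 < s" "s < 1" and r: "0 < r" "r \<le> bdist \<Omega> y / 8"
    and B: "B \<in> sets borel" "B \<subseteq> ball y r" "ball_ratio TYPE('a) * (2 * r) ^ DIM('a) \<le> measure lborel B"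
  shows "ennreal \<bar>mean_on (ball y r - ball y (r / 2)) f - mean_on B f\<bar> \<le> ennreal (step_const TYPE('a)) *
      (\<integral>\<^sup>+x\<in>ball y r - ball y (r / 2). frac_h \<Omega> s p f x / ennreal (norm (x - y) powr (real DIM('a) - s)) \<partial>lborel)"
proof -
  define n where "n = real DIM('a)"
  have n: "1 \<le> n" by (simp add: n_def DIM_positive Suc_leI)
  have h[measurable]: "frac_h \<Omega> s p f \<in> borel_measurable borel"
    using cball_half_bdist_subset \<Omega> f by (intro borel_measurable_frac_h) auto
  let ?A = "ball y r - ball y (r / 2)"
  have meas: "(\<lambda>x. frac_h \<Omega> s p f x * indicator ?A x) \<in> borel_measurable borel"
    by (intro borel_measurable_times_ennreal h borel_measurable_indicator) auto
  have sub: "cball y r \<subseteq> \<Omega>"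
    using cball_half_bdist_subset[OF \<Omega> y] subset_cball[of r "bdist \<Omega> y / 2" y] r by fastforce
  have "ennreal \<bar>mean_on ?A f - mean_on B f\<bar>
      \<le> ennreal (2 * max 1 (1 / ball_ratio TYPE('a)) / ball_ratio TYPE('a) * (2 * r) powr (s - real DIM('a)))
         * (\<integral>\<^sup>+x\<in>?A. frac_h \<Omega> s p f x \<partial>lborel)"
  proof (rule mean_on_step[OF f \<Omega>(1), where K = "cball y r" and L = "cball y r"])
    fix x assume x: "x \<in> ?A"
    have "7 / 8 * bdist \<Omega> y \<le> bdist \<Omega> x"
      using x r by (intro bdist_ball_bounds) auto
    moreover have "dist x w \<le> 2 * r" if "w \<in> B" for w
      using dist_triangle[of x w y] x B that by (auto simp: dist_commute)
    ultimately show "B \<subseteq> cball x (2 * r) \<and> 2 * r \<le> bdist \<Omega> x / 2"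
      using r by auto
  next
    show "ball_ratio TYPE('a) * (2 * r) ^ DIM('a) \<le> measure lborel ?A"
      using r by (intro ball_ratio_le_measure_annulus) auto
  qed (use B sub r p s h ball_ratio_pos in auto)
  also have "\<dots> = ennreal (step_const TYPE('a)) * (\<integral>\<^sup>+x. ennreal ((2 * r) powr (s - n)) * (frac_h \<Omega> s p f x * indicator ?A x) \<partial>lborel)"
    using step_const_pos[of "TYPE('a)"]
    by (subst nn_integral_cmult) (use meas in \<open>auto simp: step_const_def[symmetric] n_def ennreal_mult mult.assoc\<close>)
  also have "\<dots> \<le> ennreal (step_const TYPE('a)) * (\<integral>\<^sup>+x\<in>?A. frac_h \<Omega> s p f x / ennreal (norm (x - y) powr (n - s)) \<partial>lborel)"
  proof (intro mult_left_mono nn_integral_mono)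
    fix x
    show "ennreal ((2 * r) powr (s - n)) * (frac_h \<Omega> s p f x * indicator ?A x)
        \<le> frac_h \<Omega> s p f x / ennreal (norm (x - y) powr (n - s)) * indicator ?A x"
    proof (cases "x \<in> ?A")
      case True
      then have pos: "0 < norm (x - y)" and le: "norm (x - y) \<le> 2 * r"
        using r by (auto simp: dist_norm norm_minus_commute)
      have "(2 * r) powr (s - n) \<le> norm (x - y) powr (s - n)"
        using pos le s n by (intro powr_mono2') auto
      also have "\<dots> = inverse (norm (x - y) powr (n - s))"
        by (simp flip: powr_minus)
      finally have "ennreal ((2 * r) powr (s - n)) \<le> inverse (ennreal (norm (x - y) powr (n - s)))"
        using pos by (simp add: inverse_ennreal ennreal_leI)
      then have "frac_h \<Omega> s p f x * ennreal ((2 * r) powr (s - n))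
          \<le> frac_h \<Omega> s p f x * inverse (ennreal (norm (x - y) powr (n - s)))"
        by (rule mult_left_mono) simp
      then show ?thesis using True by (simp add: divide_ennreal_def mult.commute)
    qed simp
  qed simp
  finally show ?thesis by (simp add: n_def)
qed

text \<open>The means over the annuli \<open>A k\<close> of radius \<open>r k\<close> tend to \<open>f y\<close> by continuity. The steps between consecutive
annuli sum up to an integral over the whole ball because the annuli are disjoint; one more step leads from
the first annulus to the ball, whence the factor \<open>2\<close>.\<close>

lemma pointwise_minus_mean_on_ball:
  fixes f :: "'a::euclidean_space \<Rightarrow> real"
  assumes f: "continuous_on \<Omega> f" and \<Omega>: "open \<Omega>" "bounded \<Omega>" and y: "y \<in> \<Omega>"
    and p: "1 \<le> p" and s: "0 < s" "s < 1"
  shows "ennreal \<bar>f y - mean_on (ball y (bdist \<Omega> y / 8)) f\<bar> \<le> ennreal (2 * step_const TYPE('a)) *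
      (\<integral>\<^sup>+x\<in>ball y (bdist \<Omega> y / 8). frac_h \<Omega> s p f x / ennreal (norm (x - y) powr (real DIM('a) - s)) \<partial>lborel)"
proof -
  define c where "c = step_const TYPE('a)"
  have c: "0 < c" by (simp add: c_def step_const_pos)
  define r where "r k = bdist \<Omega> y / 8 / 2 ^ k" for k :: nat
  define F where "F x = frac_h \<Omega> s p f x / ennreal (norm (x - y) powr (real DIM('a) - s))" for x
  define A where "A k = ball y (r k) - ball y (r k / 2)" for k
  have r: "0 < r k" "r k \<le> bdist \<Omega> y / 8" "r (Suc k) = r k / 2" for k
    using bdist_pos[OF \<Omega> y] mult_left_mono[of 1 "2 ^ k" "bdist \<Omega> y"]
    by (auto simp: r_def field_simps)
  have r_le: "r j \<le> r k" if "k \<le> j" for j k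
  proof (rule lift_Suc_antimono_le[OF _ that])
    show "r (Suc k) \<le> r k" for k using r(1,3)[of k] by simp
  qed
  have [measurable]: "frac_h \<Omega> s p f \<in> borel_measurable borel"
    using cball_half_bdist_subset \<Omega> f by (intro borel_measurable_frac_h) auto
  have [measurable]: "F \<in> borel_measurable borel"
    unfolding F_def[abs_def] by measurable
  have telescope: "ennreal \<bar>mean_on (A 0) f - mean_on (A k) f\<bar>
      \<le> ennreal c * (\<integral>\<^sup>+x\<in>ball y (r 0) - ball y (r k). F x \<partial>lborel)" for k
  proof (induction k)
    case (Suc k)
    have step: "ennreal \<bar>mean_on (A k) f - mean_on (A (Suc k)) f\<bar> \<le> ennreal c * (\<integral>\<^sup>+x\<in>A k. F x \<partial>lborel)"
      unfolding A_def F_def c_def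
    proof (rule mean_on_annulus_step[OF f \<Omega> y p s])
      show "ball_ratio TYPE('a) * (2 * r k) ^ DIM('a) \<le> measure lborel (ball y (r (Suc k)) - ball y (r (Suc k) / 2))"
        using r(1)[of k] r(3)[of k] by (intro ball_ratio_le_measure_annulus) auto
    qed (use r[of k] r(3)[of k] in auto)
    have "ennreal \<bar>mean_on (A 0) f - mean_on (A (Suc k)) f\<bar>
        \<le> ennreal (\<bar>mean_on (A 0) f - mean_on (A k) f\<bar> + \<bar>mean_on (A k) f - mean_on (A (Suc k)) f\<bar>)"
      by (intro ennreal_leI) auto
    also have "\<dots> \<le> ennreal c * (\<integral>\<^sup>+x\<in>ball y (r 0) - ball y (r k). F x \<partial>lborel) + ennreal c * (\<integral>\<^sup>+x\<in>A k. F x \<partial>lborel)"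
      using Suc step by (simp add: add_mono)
    also have "\<dots> = ennreal c * (\<integral>\<^sup>+x\<in>(ball y (r 0) - ball y (r k)) \<union> A k. F x \<partial>lborel)"
      by (subst nn_integral_disjoint_pair) (auto simp: A_def distrib_left)
    also have "(ball y (r 0) - ball y (r k)) \<union> A k = ball y (r 0) - ball y (r (Suc k))"
      using r[of k] r_le[of 0 k] by (auto simp: A_def)
    finally show ?case .
  qed simp
  have "ennreal \<bar>f y - mean_on (ball y (r 0)) f\<bar> \<le> ennreal (2 * c) * (\<integral>\<^sup>+x\<in>ball y (r 0). F x \<partial>lborel)"
  proof (rule ennreal_le_epsilon)
    fix e :: real assume e: "0 < e"
    obtain \<delta> where \<delta>: "0 < \<delta>" "\<And>x. x \<in> \<Omega> \<Longrightarrow> dist x y < \<delta> \<Longrightarrow> dist (f x) (f y) < e"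
      using f y e unfolding continuous_on_iff by metis
    obtain k where "(1 / 2) ^ k < \<delta> / (bdist \<Omega> y / 8)"
      using real_arch_pow_inv[of "\<delta> / (bdist \<Omega> y / 8)" "1 / 2"] \<delta>(1) bdist_pos[OF \<Omega> y] by auto
    then have k: "r k < \<delta>"
      using bdist_pos[OF \<Omega> y] by (simp add: r_def field_simps)
    have sub: "cball y (r k) \<subseteq> \<Omega>"
      using cball_half_bdist_subset[OF \<Omega> y] subset_cball[of "r k" "bdist \<Omega> y / 2" y] r(1,2)[of k] by fastforce
    have "0 < ball_ratio TYPE('a) * (2 * r k) ^ DIM('a)"
      using r(1)[of k] by (intro mult_pos_pos zero_less_power ball_ratio_pos) auto
    also have "\<dots> \<le> measure lborel (A k)"
      unfolding A_def using r(1)[of k] by (intro ball_ratio_le_measure_annulus) auto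
    finally have posA: "0 < measure lborel (A k)" .
    have finA: "emeasure lborel (A k) < \<infinity>"
      unfolding A_def by (intro emeasure_bounded_finite bounded_diff bounded_ball)
    have [measurable]: "A k \<in> sets borel" by (simp add: A_def)
    have "ennreal \<bar>mean_on (A k) f - f y\<bar>
        \<le> (\<integral>\<^sup>+x\<in>A k. ennreal \<bar>f x - f y\<bar> \<partial>lborel) / ennreal (measure lborel (A k))"
      using sub posA finA
      by (intro mean_on_deviation set_integrable_continuous_subset_compact[OF f compact_cball sub])
         (auto simp: A_def)
    also have "\<dots> \<le> (\<integral>\<^sup>+x. ennreal e * indicator (A k) x \<partial>lborel) / ennreal (measure lborel (A k))"
    proof (intro divide_right_mono_ennreal nn_integral_mono)
      fix x show "ennreal \<bar>f x - f y\<bar> * indicator (A k) x \<le> ennreal e * indicator (A k) x"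
        using \<delta>(2)[of x] sub k by (auto simp: A_def indicator_def dist_commute dist_real_def subset_iff intro!: ennreal_leI intro: less_imp_le)
    qed
    also have "\<dots> = ennreal e"
      using e posA finA
      by (simp add: nn_integral_cmult emeasure_eq_ennreal_measure less_top divide_ennreal flip: ennreal_mult)
    finally have lim: "ennreal \<bar>mean_on (A k) f - f y\<bar> \<le> ennreal e" .
    have first: "ennreal \<bar>mean_on (A 0) f - mean_on (ball y (r 0)) f\<bar> \<le> ennreal c * (\<integral>\<^sup>+x\<in>A 0. F x \<partial>lborel)"
      unfolding A_def F_def c_def
    proof (rule mean_on_annulus_step[OF f \<Omega> y p s])
      show "ball_ratio TYPE('a) * (2 * r 0) ^ DIM('a) \<le> measure lborel (ball y (r 0))"
        using r(1)[of 0] by (intro ball_ratio_le_measure_ball) auto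
    qed (use r in auto)
    have "ennreal \<bar>f y - mean_on (ball y (r 0)) f\<bar> \<le> ennreal
       (\<bar>mean_on (A 0) f - mean_on (ball y (r 0)) f\<bar> + \<bar>mean_on (A 0) f - mean_on (A k) f\<bar> + \<bar>mean_on (A k) f - f y\<bar>)"
      by (intro ennreal_leI) auto
    also have "\<dots> = ennreal \<bar>mean_on (A 0) f - mean_on (ball y (r 0)) f\<bar> + ennreal \<bar>mean_on (A 0) f - mean_on (A k) f\<bar>
        + ennreal \<bar>mean_on (A k) f - f y\<bar>"
      by simp
    also have "\<dots> \<le> ennreal c * (\<integral>\<^sup>+x\<in>A 0. F x \<partial>lborel)
        + ennreal c * (\<integral>\<^sup>+x\<in>ball y (r 0) - ball y (r k). F x \<partial>lborel) + ennreal e"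
      by (intro add_mono first telescope lim)
    also have "\<dots> \<le> ennreal c * (\<integral>\<^sup>+x\<in>ball y (r 0). F x \<partial>lborel) + ennreal c * (\<integral>\<^sup>+x\<in>ball y (r 0). F x \<partial>lborel) + ennreal e"
      by (intro add_mono mult_left_mono nn_integral_mono) (auto simp: A_def indicator_def)
    also have "\<dots> = ennreal (2 * c) * (\<integral>\<^sup>+x\<in>ball y (r 0). F x \<partial>lborel) + ennreal e"
      unfolding mult_2 ennreal_plus[OF less_imp_le[OF c] less_imp_le[OF c]] distrib_right ..
    finally show "ennreal \<bar>f y - mean_on (ball y (r 0)) f\<bar> \<le> ennreal (2 * c) * (\<integral>\<^sup>+x\<in>ball y (r 0). F x \<partial>lborel) + ennreal e" .
  qed
  then show ?thesis by (simp add: r_def F_def[abs_def] c_def)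
qed

text \<open>A step between neighbouring balls of a chain. Here \<open>R = 7 / 16 * d(z)\<close>: two points of the balls are at distance
at most \<open>(3 / 8 + 1 / 64) * d(z) < R\<close>, and \<open>R \<le> d(x) / 2\<close> since \<open>d(x) \<ge> 7 / 8 * d(z)\<close>.\<close>

lemma mean_on_ball_step:
  fixes f :: "'a::euclidean_space \<Rightarrow> real"
  assumes f: "continuous_on \<Omega> f" and \<Omega>: "open \<Omega>" "bounded \<Omega>" and z: "z \<in> \<Omega>" "z' \<in> \<Omega>" "dist z z' \<le> bdist \<Omega> z / 8"
    and p: "1 \<le> p" and s: "0 < s" "s < 1"
  shows "ennreal \<bar>mean_on (ball z (bdist \<Omega> z / 8)) f - mean_on (ball z' (bdist \<Omega> z' / 8)) f\<bar>
    \<le> ennreal (3 ^ DIM('a) * step_const TYPE('a)) * (\<integral>\<^sup>+x\<in>ball z (bdist \<Omega> z / 8).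
           frac_h \<Omega> s p f x * ennreal (bdist \<Omega> x powr (s - real DIM('a))) \<partial>lborel)"
proof -
  define n where "n = real DIM('a)"
  have n: "1 \<le> n" by (simp add: n_def DIM_positive Suc_leI)
  have h[measurable]: "frac_h \<Omega> s p f \<in> borel_measurable borel"
    using cball_half_bdist_subset \<Omega> f by (intro borel_measurable_frac_h) auto
  have sub: "cball z (bdist \<Omega> z / 8) \<subseteq> \<Omega>" if "z \<in> \<Omega>" for z
    using cball_half_bdist_subset[OF \<Omega> that] subset_cball[of "bdist \<Omega> z / 8" "bdist \<Omega> z / 2" z]
      bdist_pos[OF \<Omega> that] by fastforce
  define R where "R = 7 / 16 * bdist \<Omega> z"
  have dz: "0 < bdist \<Omega> z" by (rule bdist_pos[OF \<Omega> z(1)])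
  then have R: "0 < R" by (simp add: R_def)
  let ?A = "ball z (bdist \<Omega> z / 8)"
  have meas': "(\<lambda>x. frac_h \<Omega> s p f x * ennreal (bdist \<Omega> x powr (s - n)) * indicator ?A x) \<in> borel_measurable borel"
    by (intro borel_measurable_times_ennreal h borel_measurable_indicator) auto
  have meas: "(\<lambda>x. frac_h \<Omega> s p f x * indicator ?A x) \<in> borel_measurable borel"
    by (intro borel_measurable_times_ennreal h borel_measurable_indicator) auto
  note dz' = bdist_ball_bounds[OF z(3)]
  have "ennreal \<bar>mean_on ?A f - mean_on (ball z' (bdist \<Omega> z' / 8)) f\<bar>
      \<le> ennreal (2 * max 1 (1 / ball_ratio TYPE('a)) / ball_ratio TYPE('a) * R powr (s - real DIM('a)))
         * (\<integral>\<^sup>+x\<in>?A. frac_h \<Omega> s p f x \<partial>lborel)"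
  proof (rule mean_on_step[OF f \<Omega>(1), where K = "cball z (bdist \<Omega> z / 8)" and L = "cball z' (bdist \<Omega> z' / 8)"])
    fix x assume x: "x \<in> ?A"
    have "7 / 8 * bdist \<Omega> z \<le> bdist \<Omega> x"
      using x by (intro bdist_ball_bounds) auto
    moreover have "dist x w \<le> R" if "w \<in> ball z' (bdist \<Omega> z' / 8)" for w
      using dist_triangle[of x w z] dist_triangle[of z w z'] x that z(3) dz' dz
      by (auto simp: dist_commute R_def)
    ultimately show "ball z' (bdist \<Omega> z' / 8) \<subseteq> cball x R \<and> R \<le> bdist \<Omega> x / 2"
      by (auto simp: R_def)
  next
    show "ball_ratio TYPE('a) * R ^ DIM('a) \<le> measure lborel ?A"
      "ball_ratio TYPE('a) * R ^ DIM('a) \<le> measure lborel (ball z' (bdist \<Omega> z' / 8))"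
      using dz dz' by (auto simp: R_def intro!: ball_ratio_le_measure_ball)
    show "cball z (bdist \<Omega> z / 8) \<subseteq> \<Omega>" "cball z' (bdist \<Omega> z' / 8) \<subseteq> \<Omega>"
      using sub z by blast+
  qed (use R p s h ball_ratio_pos in auto)
  also have "\<dots> = ennreal (step_const TYPE('a)) * (\<integral>\<^sup>+x. ennreal (R powr (s - n)) * (frac_h \<Omega> s p f x * indicator ?A x) \<partial>lborel)"
    using step_const_pos[of "TYPE('a)"]
    by (subst nn_integral_cmult) (use meas in \<open>auto simp: step_const_def[symmetric] n_def ennreal_mult mult.assoc\<close>)
  also have "\<dots> \<le> ennreal (step_const TYPE('a)) * (\<integral>\<^sup>+x. ennreal (3 ^ DIM('a)) *
       (frac_h \<Omega> s p f x * ennreal (bdist \<Omega> x powr (s - n)) * indicator ?A x) \<partial>lborel)"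
  proof (intro mult_left_mono nn_integral_mono)
    fix x
    show "ennreal (R powr (s - n)) * (frac_h \<Omega> s p f x * indicator ?A x)
        \<le> ennreal (3 ^ DIM('a)) * (frac_h \<Omega> s p f x * ennreal (bdist \<Omega> x powr (s - n)) * indicator ?A x)"
    proof (cases "x \<in> ?A")
      case True
      then have "bdist \<Omega> x \<le> 9 / 8 * bdist \<Omega> z" "7 / 8 * bdist \<Omega> z \<le> bdist \<Omega> x"
        using bdist_ball_bounds[of z x \<Omega>] by auto
      then have x: "0 < bdist \<Omega> x" "bdist \<Omega> x / 3 \<le> R" using dz by (auto simp: R_def)
      have "R powr (s - n) \<le> (bdist \<Omega> x / 3) powr (s - n)"
        using x s n by (intro powr_mono2') auto
      also have "\<dots> = 3 powr (n - s) * bdist \<Omega> x powr (s - n)"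
        using x powr_minus_divide[of 3 "n - s"] by (simp add: powr_divide)
      also have "\<dots> \<le> 3 powr n * bdist \<Omega> x powr (s - n)"
        using s by (intro mult_right_mono powr_mono) auto
      finally have "ennreal (R powr (s - n)) \<le> ennreal (3 ^ DIM('a)) * ennreal (bdist \<Omega> x powr (s - n))"
        by (simp add: n_def powr_realpow ennreal_leI flip: ennreal_mult)
      then have "frac_h \<Omega> s p f x * ennreal (R powr (s - n))
          \<le> frac_h \<Omega> s p f x * (ennreal (3 ^ DIM('a)) * ennreal (bdist \<Omega> x powr (s - n)))"
        by (rule mult_left_mono) simp
      then show ?thesis using True by (simp add: mult_ac)
    qed simp
  qed simp
  also have "\<dots> = ennreal (3 ^ DIM('a) * step_const TYPE('a)) * (\<integral>\<^sup>+x\<in>?A. frac_h \<Omega> s p f x * ennreal (bdist \<Omega> x powr (s - n)) \<partial>lborel)"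
    using step_const_pos[of "TYPE('a)"]
    by (subst nn_integral_cmult) (use meas' in \<open>auto simp: ennreal_mult mult_ac n_def\<close>)
  finally show ?thesis by (simp add: n_def)
qed

section \<open>Subdividing a curve by exit times\<close>

lemma speed_le_lipschitz:
  fixes g :: "real \<Rightarrow> 'a::euclidean_space"
  assumes g: "speed_le K g" and K: "0 \<le> K" and tu: "0 \<le> t" "t \<le> u" "u \<le> 1"
  shows "norm (g u - g t) \<le> K * (u - t)"
proof -
  define D where "D = (\<lambda>u. vector_derivative g (at u within {0..1}))"
  obtain N where N: "negligible N" "\<forall>v\<in>{0..1} - N. g differentiable (at v within {0..1}) \<and>
           norm (vector_derivative g (at v within {0..1})) \<le> K"
    using g unfolding speed_le_def by auto
  then have bound: "norm (D v) \<le> K" if "v \<in> {0..1}" "v \<notin> N" for v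
    using that by (simp add: D_def)
  have D: "(D has_integral (g v - g 0)) {0..v}" if "v \<in> {0..1}" for v
    using g that unfolding speed_le_def D_def by simp
  have "D integrable_on {t..u}"
  proof (rule integrable_on_subinterval)
    show "D integrable_on {0..u}"
      using D[of u] tu unfolding integrable_on_def by auto
  qed (use tu in auto)
  then obtain J where J: "(D has_integral J) {t..u}" by blast
  have "(D has_integral (g t - g 0 + J)) {0..u}"
    using tu by (intro has_integral_combine[OF _ _ D J]) auto
  moreover have "(D has_integral (g u - g 0)) {0..u}"
    using D tu by simp
  ultimately have "g t - g 0 + J = g u - g 0"
    by (rule has_integral_unique)
  then have "J = g u - g t"
    by (simp add: algebra_simps)
  have "((\<lambda>v. if v \<in> N then 0 else D v) has_integral (g u - g t)) (cbox t u)"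
  proof (rule has_integral_spike[OF N(1)])
    show "(D has_integral (g u - g t)) (cbox t u)"
      using J unfolding \<open>J = g u - g t\<close> by simp
  qed simp
  then have "norm (g u - g t) \<le> K * measure lborel (cbox t u)"
    by (rule has_integral_bound[OF K]) (use bound K tu in auto)
  then show ?thesis using tu by simp
qed

lemma first_exit:
  fixes g :: "real \<Rightarrow> 'a::real_normed_vector"
  assumes g: "continuous_on {t..v} g" and v: "t \<le> v" "\<rho> < norm (g v - g t)" and \<rho>: "0 \<le> \<rho>"
  obtains u where "t \<le> u" "u \<le> v" "norm (g u - g t) = \<rho>" "\<And>\<tau>. t \<le> \<tau> \<Longrightarrow> \<tau> \<le> u \<Longrightarrow> norm (g \<tau> - g t) \<le> \<rho>"
proof -
  define \<phi> where "\<phi> \<tau> = norm (g \<tau> - g t)" for \<tau>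
  have cont: "continuous_on {t..v} \<phi>"
    unfolding \<phi>_def by (intro continuous_intros g)
  define S where "S = {t..v} \<inter> \<phi> -` {\<rho>..}"
  have S: "closed S"
    unfolding S_def by (intro continuous_closed_preimage cont) auto
  have "v \<in> S" using v by (auto simp: S_def \<phi>_def)
  have bdd: "bdd_below S" by (auto simp: S_def)
  define u where "u = Inf S"
  have u: "u \<in> S"
    unfolding u_def using \<open>v \<in> S\<close> S bdd by (intro closed_contains_Inf) auto
  have least: "u \<le> \<tau>" if "\<tau> \<in> S" for \<tau>
    unfolding u_def using that bdd by (rule cInf_lower)
  obtain \<tau> where \<tau>: "t \<le> \<tau>" "\<tau> \<le> u" "\<phi> \<tau> = \<rho>"
    using IVT'[of \<phi> t \<rho> u] u \<rho> continuous_on_subset[OF cont, of "{t..u}"] by (auto simp: S_def \<phi>_def)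
  then have "\<tau> \<in> S" using u by (auto simp: S_def)
  then have eq: "\<phi> u = \<rho>" using least[of \<tau>] \<tau> by simp
  show thesis
  proof (rule that[of u])
    show "norm (g \<tau>' - g t) \<le> \<rho>" if "t \<le> \<tau>'" "\<tau>' \<le> u" for \<tau>'
    proof (cases "\<tau>' = u")
      case False
      then have "\<tau>' \<notin> S" using that least by force
      then show ?thesis using that u by (auto simp: S_def \<phi>_def)
    qed (use eq in \<open>simp add: \<phi>_def\<close>)
  qed (use u eq in \<open>auto simp: S_def \<phi>_def\<close>)
qed

text \<open>Consecutive times of a curve on \<open>[0, 1]\<close>, up to the final time \<open>1\<close>, such that each piece stays within the
radius \<open>\<rho>\<close> prescribed at its starting point. All pieces but the last reach that radius; the last one may
stop short of it.\<close>

definition exit_chain :: "(real \<Rightarrow> 'a::real_normed_vector) \<Rightarrow> ('a \<Rightarrow> real) \<Rightarrow> nat \<Rightarrow> (nat \<Rightarrow> real) \<Rightarrow> bool" where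
  "exit_chain g \<rho> m T \<longleftrightarrow> T (Suc m) = 1 \<and> (\<forall>i\<le>m. T i \<le> T (Suc i)) \<and>
     (\<forall>i<m. norm (g (T (Suc i)) - g (T i)) = \<rho> (g (T i))) \<and>
     (\<forall>i\<le>m. \<forall>\<tau>\<in>{T i..T (Suc i)}. norm (g \<tau> - g (T i)) \<le> \<rho> (g (T i)))"

text \<open>A piece that reaches its radius, which is at least \<open>r\<close>, takes time at least \<open>r / K\<close>. So finitely many pieces
exhaust the curve, and the induction is on the number of time units \<open>r / K\<close> that are left.\<close>

lemma exit_chain_exists:
  fixes g :: "real \<Rightarrow> 'a::real_normed_vector"
  assumes cont: "continuous_on {0..1} g" and K: "0 < K"
    and lip: "\<And>t u. 0 \<le> t \<Longrightarrow> t \<le> u \<Longrightarrow> u \<le> 1 \<Longrightarrow> norm (g u - g t) \<le> K * (u - t)"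
    and \<rho>: "0 < r" "\<And>t. 0 \<le> t \<Longrightarrow> t \<le> 1 \<Longrightarrow> r \<le> \<rho> (g t)"
  obtains m T where "exit_chain g \<rho> m T" "T 0 = 0"
proof -
  have "\<exists>m T. exit_chain g \<rho> m T \<and> T 0 = t" if "0 \<le> t" "t \<le> 1" "1 - t \<le> real N * (r / K)" for N t
    using that
  proof (induction N arbitrary: t)
    case 0
    then have "t = 1" by simp
    then have "exit_chain g \<rho> 0 (\<lambda>_. 1)"
      using \<rho>(1) \<rho>(2)[of 1] by (auto simp: exit_chain_def)
    then show ?case using \<open>t = 1\<close> by blast
  next
    case (Suc N)
    show ?case
    proof (cases "\<forall>\<tau>\<in>{t..1}. norm (g \<tau> - g t) \<le> \<rho> (g t)")
      case True
      then have "exit_chain g \<rho> 0 (case_nat t (\<lambda>_. 1))"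
        using Suc.prems by (auto simp: exit_chain_def)
      then show ?thesis by (intro exI[of _ "0::nat"] exI[of _ "case_nat t (\<lambda>_. 1)"]) simp
    next
      case False
      then obtain v where v: "t \<le> v" "v \<le> 1" "\<rho> (g t) < norm (g v - g t)" by force
      have pos: "r \<le> \<rho> (g t)" using \<rho>(2) Suc.prems by simp
      then have \<rho>_nonneg: "0 \<le> \<rho> (g t)" using \<rho>(1) by simp
      have "continuous_on {t..v} g"
        using v Suc.prems by (intro continuous_on_subset[OF cont]) auto
      then obtain u where u: "t \<le> u" "u \<le> v" "norm (g u - g t) = \<rho> (g t)"
          and inside: "\<And>\<tau>. t \<le> \<tau> \<Longrightarrow> \<tau> \<le> u \<Longrightarrow> norm (g \<tau> - g t) \<le> \<rho> (g t)"
        using first_exit[OF _ v(1,3) \<rho>_nonneg] by blast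
      have "r \<le> K * (u - t)" using lip[of t u] u v pos Suc.prems by simp
      then have "r / K \<le> u - t" using K by (simp add: field_simps)
      then have "1 - u \<le> real N * (r / K)" using Suc.prems by (simp add: algebra_simps)
      then obtain m T where T: "exit_chain g \<rho> m T" "T 0 = u"
        using Suc.IH[of u] u v Suc.prems by auto
      have "exit_chain g \<rho> (Suc m) (case_nat t T)"
        unfolding exit_chain_def
      proof (intro conjI allI impI ballI)
        fix i \<tau>
        show "i \<le> Suc m \<Longrightarrow> case_nat t T i \<le> case_nat t T (Suc i)"
          using T u by (cases i) (auto simp: exit_chain_def)
        show "i < Suc m \<Longrightarrow> norm (g (case_nat t T (Suc i)) - g (case_nat t T i)) = \<rho> (g (case_nat t T i))"
          using T u by (cases i) (auto simp: exit_chain_def)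
        show "i \<le> Suc m \<Longrightarrow> \<tau> \<in> {case_nat t T i..case_nat t T (Suc i)}
            \<Longrightarrow> norm (g \<tau> - g (case_nat t T i)) \<le> \<rho> (g (case_nat t T i))"
          using T u inside by (cases i) (auto simp: exit_chain_def)
      qed (use T in \<open>simp add: exit_chain_def\<close>)
      then show ?thesis by (intro exI[of _ "Suc m"] exI[of _ "case_nat t T"]) simp
    qed
  qed
  note chain = this
  obtain N :: nat where "1 / (r / K) < real N" using reals_Archimedean2 by blast
  then have "1 - 0 \<le> real N * (r / K)" using K \<rho>(1) by (simp add: field_simps)
  then show thesis using chain[of 0 N] that by auto
qed

text \<open>The intervals enter \<open>curve_length\<close> as a set. As they have disjoint nonempty interiors, no two of them
coincide, and the sum over the set is the sum over the indices.\<close>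

lemma sum_chords_le_curve_length:
  fixes g :: "real \<Rightarrow> 'a::euclidean_space" and T :: "nat \<Rightarrow> real"
  assumes I: "finite I" and lt: "\<And>i. i \<in> I \<Longrightarrow> T i < T (Suc i)"
    and ord: "\<And>i j. i \<in> I \<Longrightarrow> j \<in> I \<Longrightarrow> i < j \<Longrightarrow> T (Suc i) \<le> T j"
    and sub: "\<And>i. i \<in> I \<Longrightarrow> {T i..T (Suc i)} \<subseteq> S"
  shows "(\<Sum>i\<in>I. ennreal (norm (g (T (Suc i)) - g (T i)))) \<le> curve_length g S"
proof -
  define J where "J i = {T i..T (Suc i)}" for i
  have disj: "interior (J i) \<inter> interior (J j) = {}" if "i \<in> I" "j \<in> I" "i \<noteq> j" for i j
    using that ord[of i j] ord[of j i] by (cases i j rule: linorder_cases) (auto simp: J_def)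
  have ne: "interior (J i) \<noteq> {}" if "i \<in> I" for i
    using lt[OF that] by (simp add: J_def)
  have inj: "inj_on J I"
  proof (rule inj_onI, rule ccontr)
    fix i j assume "i \<in> I" "j \<in> I" "J i = J j" "i \<noteq> j"
    then show False using disj[of i j] ne[of j] by simp
  qed
  have "(J ` I) division_of \<Union>(J ` I)"
    unfolding division_of_def
  proof (intro conjI ballI impI)
    fix A assume "A \<in> J ` I"
    then obtain i where i: "i \<in> I" "A = J i" by blast
    show "A \<subseteq> \<Union>(J ` I)" using i by blast
    show "A \<noteq> {}" using i lt[of i] by (simp add: J_def)
    show "\<exists>a b. A = cbox a b" using i by (auto simp: J_def box_real)
    fix B assume "B \<in> J ` I" "A \<noteq> B"
    then show "interior A \<inter> interior B = {}" using i disj by blast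
  qed (use I in auto)
  moreover have "\<Union>(J ` I) \<subseteq> S" using sub by (auto simp: J_def)
  ultimately have "(\<Sum>A\<in>J ` I. ennreal (norm (g (Sup A) - g (Inf A)))) \<le> curve_length g S"
    unfolding curve_length_def by (intro SUP_upper) auto
  also have "(\<Sum>A\<in>J ` I. ennreal (norm (g (Sup A) - g (Inf A)))) = (\<Sum>i\<in>I. ennreal (norm (g (T (Suc i)) - g (T i))))"
    using lt by (subst sum.reindex[OF inj]) (auto simp: J_def less_imp_le intro!: sum.cong)
  finally show ?thesis .
qed

text \<open>Comparison of one term of a Riemann sum with the integral of \<open>t powr (\<delta> - 1)\<close> over \<open>[a, b]\<close>, by evaluating the
decreasing integrand at the right end point.\<close>

lemma powr_increment_bound:
  fixes a b \<delta> :: real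
  assumes "0 \<le> a" "a \<le> b" "0 < b" "0 < \<delta>" "\<delta> \<le> 1"
  shows "(b - a) * b powr (\<delta> - 1) \<le> (b powr \<delta> - a powr \<delta>) / \<delta>"
proof (cases "a < b")
  case True
  have cont: "continuous_on {a..b} (\<lambda>x. x powr \<delta>)"
    using assms by (intro continuous_on_powr' continuous_on_id continuous_on_const) auto
  have "(\<lambda>x. x powr \<delta>) differentiable (at x)" if "a < x" for x
    using that assms has_real_derivative_powr[of x \<delta>] real_differentiable_def by auto
  then obtain l z where z: "a < z" "z < b" "DERIV (\<lambda>x. x powr \<delta>) z :> l" "b powr \<delta> - a powr \<delta> = (b - a) * l"
    using MVT[OF True cont] by blast
  have "l = \<delta> * z powr (\<delta> - 1)"
    using z assms by (intro DERIV_unique[OF z(3)] has_real_derivative_powr) auto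
  moreover have "b powr (\<delta> - 1) \<le> z powr (\<delta> - 1)"
    using z assms by (intro powr_mono2') auto
  ultimately have "(b - a) * b powr (\<delta> - 1) \<le> (b - a) * (l / \<delta>)"
    using assms True by (intro mult_left_mono) auto
  also have "\<dots> = (b powr \<delta> - a powr \<delta>) / \<delta>" using z by simp
  finally show ?thesis .
qed (use assms in auto)

text \<open>Splitting \<open>D powr (1 - 1 / \<beta> + \<epsilon>)\<close> as \<open>D * D powr (\<epsilon> - 1 / \<beta>)\<close>, the first factor is bounded by the time increment
and the second, having a nonpositive exponent, by a power of the time. The result is a Riemann sum of
\<open>t powr (\<epsilon> * \<beta> - 1)\<close>, which telescopes after \<open>powr_increment_bound\<close>.\<close>

lemma sum_powr_chain_bound:
  fixes T D :: "nat \<Rightarrow> real"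
  assumes \<beta>: "1 \<le> \<beta>" and \<epsilon>: "0 < \<epsilon>" "\<epsilon> \<le> 1 / \<beta>" and L: "0 < L" and \<mu>: "0 < \<mu>"
    and T: "T 0 = 0" "T m \<le> 1" "\<And>i. i < m \<Longrightarrow> T i \<le> T (Suc i)" "\<And>i. i \<le> m \<Longrightarrow> 0 \<le> T i"
    and D: "\<And>i. i < m \<Longrightarrow> 0 < D i" "\<And>i. i < m \<Longrightarrow> D i \<le> L * (T (Suc i) - T i)"
      "\<And>i. i < m \<Longrightarrow> \<mu> * T (Suc i) powr \<beta> \<le> D i"
  shows "(\<Sum>i<m. D i powr (1 - 1 / \<beta> + \<epsilon>)) \<le> L * \<mu> powr (\<epsilon> - 1 / \<beta>) / (\<epsilon> * \<beta>)"
proof -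
  define \<delta> where "\<delta> = \<epsilon> * \<beta>"
  have \<delta>: "0 < \<delta>" "\<delta> \<le> 1" using \<epsilon> \<beta> by (auto simp: \<delta>_def field_simps)
  have exp: "\<beta> * (\<epsilon> - 1 / \<beta>) = \<delta> - 1" using \<beta> by (simp add: \<delta>_def field_simps)
  have term_bound: "D i powr (1 - 1 / \<beta> + \<epsilon>) \<le> L * \<mu> powr (\<epsilon> - 1 / \<beta>) / \<delta> * (T (Suc i) powr \<delta> - T i powr \<delta>)" if i: "i < m" for i
  proof -
    have pos: "0 < T (Suc i)"
    proof -
      have "0 < L * (T (Suc i) - T i)" using D(1,2)[OF i] by simp
      then show ?thesis using T(4)[of i] i L by (simp add: zero_less_mult_iff)
    qed
    have "D i powr (1 - 1 / \<beta> + \<epsilon>) = D i * D i powr (\<epsilon> - 1 / \<beta>)"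
      using D(1)[OF i] powr_add[of "D i" 1 "\<epsilon> - 1 / \<beta>"] by (simp add: algebra_simps)
    also have "\<dots> \<le> (L * (T (Suc i) - T i)) * (\<mu> * T (Suc i) powr \<beta>) powr (\<epsilon> - 1 / \<beta>)"
      using D[OF i] pos \<mu> \<epsilon> T(3)[OF i] L by (intro mult_mono powr_mono2') auto
    also have "\<dots> = L * \<mu> powr (\<epsilon> - 1 / \<beta>) * ((T (Suc i) - T i) * T (Suc i) powr (\<delta> - 1))"
      using pos \<mu> exp by (simp add: powr_mult powr_powr)
    also have "\<dots> \<le> L * \<mu> powr (\<epsilon> - 1 / \<beta>) * ((T (Suc i) powr \<delta> - T i powr \<delta>) / \<delta>)"
      using pos i T \<delta> L by (intro mult_left_mono powr_increment_bound) auto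
    finally show ?thesis by simp
  qed
  have "(\<Sum>i<m. D i powr (1 - 1 / \<beta> + \<epsilon>)) \<le> (\<Sum>i<m. L * \<mu> powr (\<epsilon> - 1 / \<beta>) / \<delta> * (T (Suc i) powr \<delta> - T i powr \<delta>))"
    by (intro sum_mono term_bound) auto
  also have "\<dots> = L * \<mu> powr (\<epsilon> - 1 / \<beta>) / \<delta> * (T m powr \<delta>)"
    using T(1) sum_lessThan_telescope[of "\<lambda>i. T i powr \<delta>" m] by (simp only: sum_distrib_left[symmetric]) simp
  also have "\<dots> \<le> L * \<mu> powr (\<epsilon> - 1 / \<beta>) / \<delta> * 1"
    using T(2) T(4)[of m] \<delta> L powr_mono2[of \<delta> "T m" 1] by (intro mult_left_mono) auto
  finally show ?thesis by (simp add: \<delta>_def)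
qed

section \<open>Chains of balls along John curves\<close>

text \<open>What is kept of the curve joining \<open>y\<close> to \<open>0\<close>: the points \<open>z i\<close> are its positions at the times \<open>T i\<close>. The step
from \<open>z m\<close> to \<open>0\<close> comes without a time, as its piece of the curve may be much shorter than the radius. The
number \<open>M\<close> bounds the overlap of the balls.\<close>

definition whitney_chain ::
  "'a::euclidean_space set \<Rightarrow> real \<Rightarrow> real \<Rightarrow> real \<Rightarrow> real \<Rightarrow> 'a \<Rightarrow> nat \<Rightarrow> (nat \<Rightarrow> real) \<Rightarrow> (nat \<Rightarrow> 'a) \<Rightarrow> bool"
where
  "whitney_chain \<Omega> \<beta> lam K M y m T z \<longleftrightarrow>
     T 0 = 0 \<and> T m \<le> 1 \<and> (\<forall>i\<le>m. 0 \<le> T i) \<and> (\<forall>i<m. T i \<le> T (Suc i)) \<and>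
     z 0 = y \<and> z (Suc m) = 0 \<and> (\<forall>i\<le>Suc m. z i \<in> \<Omega>) \<and>
     (\<forall>i\<le>m. dist (z i) (z (Suc i)) \<le> bdist \<Omega> (z i) / 8) \<and>
     (\<forall>i<m. bdist \<Omega> (z i) / 8 \<le> K * (T (Suc i) - T i)) \<and>
     (\<forall>i\<le>m. lam * T i powr \<beta> \<le> bdist \<Omega> (z i)) \<and> (\<forall>i\<le>m. dist y (z i) \<le> K * T i) \<and>
     (\<forall>x\<in>\<Omega>. real (card {i. i \<le> m \<and> x \<in> ball (z i) (bdist \<Omega> (z i) / 8)}) \<le> M)"

text \<open>The points lie at the exit times of the curve for the radius \<open>d / 8\<close>. The length condition of a John domain bounds
the overlap of the balls. If the \<open>i\<close>-th ball contains \<open>x\<close> and \<open>i < m\<close>, the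
\<open>i\<close>-th piece of the curve stays in the ball \<open>B(x, d(x) / 2)\<close> and its chord has length \<open>d(z i) / 8 \<ge> d(x) / 9\<close>.
These pieces do not overlap in time, so there are at most \<open>9 / 2 * C0\<close> of them; the ball number \<open>m\<close> adds one.\<close>

lemma john_domain_chains:
  fixes \<Omega> :: "'a::euclidean_space set"
  assumes john: "john_domain \<beta> \<Omega>" and \<beta>: "1 \<le> \<beta>"
  obtains lam K M :: real where "0 < lam" "0 < K" "0 < M"
    "\<And>y. y \<in> \<Omega> \<Longrightarrow> \<exists>m T z. whitney_chain \<Omega> \<beta> lam K M y m T z"
proof -
  have \<Omega>: "open \<Omega>" "bounded \<Omega>" using john by (auto simp: john_domain_def)
  obtain \<gamma> :: "real \<Rightarrow> 'a \<Rightarrow> 'a" and lam K C0 where c: "lam > 0" "K > 0" "C0 > 0"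
    and "\<forall>y\<in>\<Omega>. rectifiable (\<lambda>t. \<gamma> t y) \<and> (\<forall>t\<in>{0..1}. \<gamma> t y \<in> \<Omega>)"
    and "\<forall>y\<in>\<Omega>. \<gamma> 0 y = y \<and> \<gamma> 1 y = 0"
    and "\<forall>y\<in>\<Omega>. \<forall>t\<in>{0..1}. bdist \<Omega> (\<gamma> t y) \<ge> lam * t powr \<beta>"
    and "\<forall>y\<in>\<Omega>. speed_le K (\<lambda>t. \<gamma> t y)"
    and "\<forall>x\<in>\<Omega>. \<forall>y\<in>\<Omega>. \<forall>r. 0 < r \<and> r \<le> bdist \<Omega> x / 2 \<longrightarrow>
           curve_length (\<lambda>t. \<gamma> t y) {t \<in> {0..1}. \<gamma> t y \<in> ball x r} \<le> ennreal (C0 * r)"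
    using john unfolding john_domain_def by (elim conjE exE) (rule that; assumption)
  then have rect: "rectifiable (\<lambda>t. \<gamma> t y)"
    and in\<Omega>: "t \<in> {0..1} \<Longrightarrow> \<gamma> t y \<in> \<Omega>"
    and ends: "\<gamma> 0 y = y" "\<gamma> 1 y = 0"
    and dist_bd: "t \<in> {0..1} \<Longrightarrow> lam * t powr \<beta> \<le> bdist \<Omega> (\<gamma> t y)"
    and speed: "speed_le K (\<lambda>t. \<gamma> t y)"
    and len: "x \<in> \<Omega> \<Longrightarrow> 0 < r \<Longrightarrow> r \<le> bdist \<Omega> x / 2 \<Longrightarrow>
           curve_length (\<lambda>t. \<gamma> t y) {t \<in> {0..1}. \<gamma> t y \<in> ball x r} \<le> ennreal (C0 * r)"
    if "y \<in> \<Omega>" for x y t r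
    using that by blast+
  define M where "M = 9 / 2 * C0 + 1"
  show thesis
  proof (rule that[OF c(1,2)])
    show "0 < M" using c by (simp add: M_def)
    fix y assume y: "y \<in> \<Omega>"
    define g where "g = (\<lambda>t. \<gamma> t y)"
    have g\<Omega>: "g t \<in> \<Omega>" if "0 \<le> t" "t \<le> 1" for t using in\<Omega>[OF y] that by (simp add: g_def)
    have cont: "continuous_on {0..1} g"
      using rect[OF y] by (simp add: rectifiable_def path_def g_def)
    have lip: "norm (g u - g t) \<le> K * (u - t)" if "0 \<le> t" "t \<le> u" "u \<le> 1" for t u
      using speed_le_lipschitz[OF speed[OF y] less_imp_le[OF c(2)] that] by (simp add: g_def)
    \<comment> \<open>The John condition gives no lower bound for the distance to the boundary at time \<open>0\<close>;
      compactness of the curve does.\<close>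
    have "\<exists>t0\<in>{0..1}. \<forall>t\<in>{0..1}. bdist \<Omega> (g t0) \<le> bdist \<Omega> (g t)"
      by (intro continuous_attains_inf continuous_intros cont) auto
    then obtain t0 where t0: "0 \<le> t0" "t0 \<le> 1" "\<And>t. 0 \<le> t \<Longrightarrow> t \<le> 1 \<Longrightarrow> bdist \<Omega> (g t0) \<le> bdist \<Omega> (g t)"
      by auto
    have "0 < bdist \<Omega> (g t0) / 8" using bdist_pos[OF \<Omega> g\<Omega>[OF t0(1,2)]] by simp
    moreover have "bdist \<Omega> (g t0) / 8 \<le> bdist \<Omega> (g t) / 8" if "0 \<le> t" "t \<le> 1" for t
      using t0(3)[OF that] by simp
    ultimately obtain m T where chain: "exit_chain g (\<lambda>x. bdist \<Omega> x / 8) m T" and T0: "T 0 = 0"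
      using exit_chain_exists[OF cont c(2) lip, of "bdist \<Omega> (g t0) / 8" "\<lambda>x. bdist \<Omega> x / 8"] by blast
    have last: "T (Suc m) = 1" and step: "\<And>i. i \<le> m \<Longrightarrow> T i \<le> T (Suc i)"
      and exit: "\<And>i. i < m \<Longrightarrow> norm (g (T (Suc i)) - g (T i)) = bdist \<Omega> (g (T i)) / 8"
      and inside: "\<And>i \<tau>. i \<le> m \<Longrightarrow> T i \<le> \<tau> \<Longrightarrow> \<tau> \<le> T (Suc i) \<Longrightarrow> norm (g \<tau> - g (T i)) \<le> bdist \<Omega> (g (T i)) / 8"
      using chain by (auto simp: exit_chain_def)
    have mono: "T i \<le> T j" if "i \<le> j" "j \<le> Suc m" for i j
      using that by (induction j rule: dec_induct) (auto intro: order_trans[OF _ step])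
    have range: "0 \<le> T i" "T i \<le> 1" if "i \<le> Suc m" for i
      using mono[of 0 i] mono[of i "Suc m"] that T0 last by auto
    define z where "z i = g (T i)" for i
    have z\<Omega>: "z i \<in> \<Omega>" if "i \<le> Suc m" for i using range[OF that] g\<Omega> by (simp add: z_def)
    have overlap: "real (card {i. i \<le> m \<and> x \<in> ball (z i) (bdist \<Omega> (z i) / 8)}) \<le> M" if x: "x \<in> \<Omega>" for x
    proof -
      define I where "I = {i. i < m \<and> x \<in> ball (z i) (bdist \<Omega> (z i) / 8)}"
      have fin: "finite I" by (simp add: I_def)
      have dx: "0 < bdist \<Omega> x" by (rule bdist_pos[OF \<Omega> x])
      have comp: "bdist \<Omega> x \<le> 9 / 8 * bdist \<Omega> (z i)" "7 / 8 * bdist \<Omega> (z i) \<le> bdist \<Omega> x" if "i \<in> I" for i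
        using bdist_ball_bounds[of "z i" x \<Omega>] that by (auto simp: I_def)
      have "ennreal (real (card I) * (bdist \<Omega> x / 9)) = (\<Sum>i\<in>I. ennreal (bdist \<Omega> x / 9))"
        using dx by (subst sum_ennreal) auto
      also have "\<dots> \<le> (\<Sum>i\<in>I. ennreal (norm (g (T (Suc i)) - g (T i))))"
      proof (intro sum_mono ennreal_leI)
        fix i assume i: "i \<in> I"
        then show "bdist \<Omega> x / 9 \<le> norm (g (T (Suc i)) - g (T i))"
          using comp(1)[OF i] exit[of i] by (simp add: I_def z_def)
      qed
      also have "\<dots> \<le> curve_length g {t \<in> {0..1}. g t \<in> ball x (bdist \<Omega> x / 2)}"
      proof (rule sum_chords_le_curve_length[OF fin])
        fix i assume i: "i \<in> I"
        then have im: "i < m" and xi: "dist (z i) x < bdist \<Omega> (z i) / 8" by (auto simp: I_def)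
        have "0 < bdist \<Omega> (z i)" using bdist_pos[OF \<Omega> z\<Omega>[of i]] im by simp
        then have "g (T (Suc i)) \<noteq> g (T i)" using exit[OF im] by (auto simp: z_def)
        then show "T i < T (Suc i)" using step[of i] im by (metis less_imp_le order_le_less)
        show "{T i..T (Suc i)} \<subseteq> {t \<in> {0..1}. g t \<in> ball x (bdist \<Omega> x / 2)}"
        proof
          fix \<tau> assume \<tau>: "\<tau> \<in> {T i..T (Suc i)}"
          then have "dist (g \<tau>) (z i) \<le> bdist \<Omega> (z i) / 8"
            using inside[of i \<tau>] im by (simp add: z_def dist_norm)
          then have "dist x (g \<tau>) < bdist \<Omega> x / 2"
            using dist_triangle[of x "g \<tau>" "z i"] xi comp(2)[OF i] dx by (simp add: dist_commute)
          then show "\<tau> \<in> {t \<in> {0..1}. g t \<in> ball x (bdist \<Omega> x / 2)}"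
            using \<tau> range[of i] range[of "Suc i"] im by auto
        qed
        fix j assume "j \<in> I" "i < j"
        then show "T (Suc i) \<le> T j" by (intro mono) (auto simp: I_def)
      qed
      also have "\<dots> \<le> ennreal (C0 * (bdist \<Omega> x / 2))"
        using len[OF y x, of "bdist \<Omega> x / 2"] dx by (simp add: g_def)
      finally have "real (card I) * (bdist \<Omega> x / 9) \<le> C0 * (bdist \<Omega> x / 2)"
        using c dx by (simp add: ennreal_le_iff)
      then have cardI: "real (card I) \<le> 9 / 2 * C0" using dx by (simp add: field_simps)
      have "{i. i \<le> m \<and> x \<in> ball (z i) (bdist \<Omega> (z i) / 8)} \<subseteq> insert m I"
        by (auto simp: I_def)
      then have "card {i. i \<le> m \<and> x \<in> ball (z i) (bdist \<Omega> (z i) / 8)} \<le> card (insert m I)"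
        using fin by (intro card_mono) auto
      also have "\<dots> \<le> Suc (card I)" by (simp add: card_insert_if fin)
      finally show ?thesis using cardI by (simp add: M_def)
    qed
    have "dist (z i) (z (Suc i)) \<le> bdist \<Omega> (z i) / 8" if "i \<le> m" for i
      using inside[OF that, of "T (Suc i)"] step[OF that] by (simp add: z_def dist_norm norm_minus_commute)
    moreover have "bdist \<Omega> (z i) / 8 \<le> K * (T (Suc i) - T i)" if "i < m" for i
      using exit[OF that] lip[of "T i" "T (Suc i)"] range[of i] range[of "Suc i"] step[of i] that by (simp add: z_def)
    moreover have "lam * T i powr \<beta> \<le> bdist \<Omega> (z i)" if "i \<le> m" for i
      using dist_bd[OF y, of "T i"] range[of i] that by (simp add: z_def g_def)
    moreover have "dist y (z i) \<le> K * T i" if "i \<le> m" for i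
      using lip[of 0 "T i"] range[of i] that ends(1)[OF y] by (simp add: z_def g_def dist_norm norm_minus_commute)
    moreover have "z 0 = y" "z (Suc m) = 0"
      using ends y T0 last by (auto simp: z_def g_def)
    ultimately have "whitney_chain \<Omega> \<beta> lam K M y m T z"
      unfolding whitney_chain_def
      using T0 range step z\<Omega> overlap
      by auto
    then show "\<exists>m T z. whitney_chain \<Omega> \<beta> lam K M y m T z" by blast
  qed
qed

section \<open>Estimates along a chain\<close>

abbreviation whitney_ball :: "'a::euclidean_space set \<Rightarrow> 'a \<Rightarrow> 'a set" where
  "whitney_ball \<Omega> z \<equiv> ball z (bdist \<Omega> z / 8)"

lemma bdist_le_bound:
  fixes \<Omega> :: "'a::euclidean_space set"
  assumes "open \<Omega>" "bounded \<Omega>"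
  obtains D where "1 \<le> D" "\<And>x. x \<in> \<Omega> \<Longrightarrow> bdist \<Omega> x \<le> D"
proof (cases "frontier \<Omega> = {}")
  case False
  then obtain a where a: "a \<in> frontier \<Omega>" by blast
  obtain D where D: "\<And>x. x \<in> \<Omega> \<Longrightarrow> dist a x \<le> D"
    using assms(2) bounded_any_center[of \<Omega> a] by auto
  show thesis
  proof (rule that[of "max 1 D"])
    show "bdist \<Omega> x \<le> max 1 D" if "x \<in> \<Omega>" for x
      using infdist_le[OF a, of x] D[OF that] by (simp add: dist_commute)
  qed simp
next
  case True
  then show thesis using that[of 1] by (simp add: infdist_def)
qed

text \<open>The steps add up to an integral against the number of balls containing \<open>x\<close>, which is at most \<open>M\<close>.\<close>

lemma whitney_chain_mean_difference:
  fixes f :: "'a::euclidean_space \<Rightarrow> real"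
  assumes f: "continuous_on \<Omega> f" and \<Omega>: "open \<Omega>" "bounded \<Omega>" and p: "1 \<le> p" and s: "0 < s" "s < 1"
    and M: "0 \<le> M" and chain: "whitney_chain \<Omega> \<beta> lam K M y m T z"
  shows "ennreal \<bar>mean_on (whitney_ball \<Omega> y) f - mean_on (whitney_ball \<Omega> 0) f\<bar>
    \<le> ennreal (3 ^ DIM('a) * step_const TYPE('a) * M) * (\<integral>\<^sup>+x\<in>(\<Union>i\<le>m. whitney_ball \<Omega> (z i)).
           frac_h \<Omega> s p f x * ennreal (bdist \<Omega> x powr (s - real DIM('a))) \<partial>lborel)"
proof -
  define c where "c = 3 ^ DIM('a) * step_const TYPE('a)"
  have c: "0 < c" by (simp add: c_def step_const_pos)
  define B where "B i = whitney_ball \<Omega> (z i)" for i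
  define a where "a i = mean_on (B i) f" for i
  define F where "F x = frac_h \<Omega> s p f x * ennreal (bdist \<Omega> x powr (s - real DIM('a)))" for x
  have [measurable]: "frac_h \<Omega> s p f \<in> borel_measurable borel"
    using cball_half_bdist_subset \<Omega> f by (intro borel_measurable_frac_h) auto
  have [measurable]: "F \<in> borel_measurable borel" unfolding F_def[abs_def] by measurable
  have [measurable]: "B i \<in> sets borel" for i by (simp add: B_def)
  have ends: "z 0 = y" "z (Suc m) = 0" using chain by (auto simp: whitney_chain_def)
  have overlap: "real (card {i. i \<le> m \<and> x \<in> B i}) \<le> M" if "x \<in> \<Omega>" for x
    using chain that by (auto simp: whitney_chain_def B_def)
  have sub: "B i \<subseteq> \<Omega>" if "i \<le> m" for i
  proof -
    have "z i \<in> \<Omega>" using chain that by (auto simp: whitney_chain_def)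
    moreover have "B i \<subseteq> ball (z i) (bdist \<Omega> (z i))"
      using bdist_pos[OF \<Omega> \<open>z i \<in> \<Omega>\<close>] by (auto simp: B_def)
    ultimately show ?thesis using ball_bdist_subset by blast
  qed
  have "ennreal \<bar>a 0 - a (Suc k)\<bar> \<le> (\<Sum>i\<le>k. ennreal c * (\<integral>\<^sup>+x. F x * indicator (B i) x \<partial>lborel))" if "k \<le> m" for k
    using that
  proof (induction k)
    case 0
    then show ?case
      using chain f \<Omega> p s unfolding a_def B_def F_def c_def
      by (simp del: ends) (intro mean_on_ball_step; auto simp: whitney_chain_def)
  next
    case (Suc k)
    have "ennreal \<bar>a 0 - a (Suc (Suc k))\<bar> \<le> ennreal (\<bar>a 0 - a (Suc k)\<bar> + \<bar>a (Suc k) - a (Suc (Suc k))\<bar>)"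
      by (intro ennreal_leI) auto
    also have "\<dots> = ennreal \<bar>a 0 - a (Suc k)\<bar> + ennreal \<bar>a (Suc k) - a (Suc (Suc k))\<bar>"
      by simp
    also have "ennreal \<bar>a (Suc k) - a (Suc (Suc k))\<bar> \<le> ennreal c * (\<integral>\<^sup>+x. F x * indicator (B (Suc k)) x \<partial>lborel)"
      using chain Suc.prems unfolding a_def B_def F_def c_def
      by (intro mean_on_ball_step f \<Omega> p s) (auto simp: whitney_chain_def)
    finally show ?case using Suc by (simp add: add_right_mono order_trans)
  qed
  from this[OF order_refl] have "ennreal \<bar>mean_on (whitney_ball \<Omega> y) f - mean_on (whitney_ball \<Omega> 0) f\<bar>
      \<le> (\<Sum>i\<le>m. ennreal c * (\<integral>\<^sup>+x. F x * indicator (B i) x \<partial>lborel))"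
    by (simp add: a_def B_def ends)
  also have "\<dots> = ennreal c * (\<integral>\<^sup>+x. (\<Sum>i\<le>m. F x * indicator (B i) x) \<partial>lborel)"
    by (subst nn_integral_sum) (auto simp only: sum_distrib_left, measurable)
  also have "\<dots> \<le> ennreal c * (\<integral>\<^sup>+x. ennreal M * (F x * indicator (\<Union>i\<le>m. B i) x) \<partial>lborel)"
  proof (intro mult_left_mono nn_integral_mono)
    fix x
    have "(\<Sum>i\<le>m. F x * indicator (B i) x) = F x * of_nat (card {i. i \<le> m \<and> x \<in> B i})"
    proof -
      have "(\<Sum>i\<le>m. indicator (B i) x :: ennreal) = (\<Sum>i\<le>m. if x \<in> B i then 1 else 0)"
        by (intro sum.cong) (auto simp: indicator_def)
      also have "\<dots> = (\<Sum>i\<in>{i\<in>{..m}. x \<in> B i}. 1)"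
        by (rule sum.inter_filter[symmetric]) simp
      finally have "(\<Sum>i\<le>m. indicator (B i) x :: ennreal) = of_nat (card {i. i \<le> m \<and> x \<in> B i})"
        by simp
      then show ?thesis by (simp only: sum_distrib_left[symmetric])
    qed
    also have "\<dots> \<le> ennreal M * (F x * indicator (\<Union>i\<le>m. B i) x)"
    proof (cases "\<exists>i\<le>m. x \<in> B i")
      case True
      then have "x \<in> \<Omega>" using sub by blast
      then have "of_nat (card {i. i \<le> m \<and> x \<in> B i}) \<le> ennreal M"
        using overlap by (simp add: ennreal_of_nat_eq_real_of_nat ennreal_leI)
      then have "F x * of_nat (card {i. i \<le> m \<and> x \<in> B i}) \<le> F x * ennreal M"
        by (rule mult_left_mono) simp
      moreover have "x \<in> (\<Union>i\<le>m. B i)" using True by blast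
      ultimately show ?thesis by (simp add: mult.commute)
    next
      case False
      then have "{i. i \<le> m \<and> x \<in> B i} = {}" by blast
      then show ?thesis by (simp del: Collect_empty_eq)
    qed
    finally show "(\<Sum>i\<le>m. F x * indicator (B i) x) \<le> ennreal M * (F x * indicator (\<Union>i\<le>m. B i) x)" .
  qed simp
  also have "\<dots> = ennreal (c * M) * (\<integral>\<^sup>+x\<in>(\<Union>i\<le>m. B i). F x \<partial>lborel)"
    using c M by (simp add: nn_integral_cmult ennreal_mult mult.assoc)
  finally show ?thesis by (simp add: c_def B_def F_def)
qed

text \<open>On the \<open>i\<close>-th ball the distance is comparable to \<open>d(z i)\<close>, so the ball contributes about \<open>d(z i) powr (k + n)\<close>.
The exponent \<open>k\<close> may be decreased, as the distance is bounded; this brings \<open>k + n\<close> into the form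
\<open>1 - 1 / \<beta> + \<epsilon>\<close> with \<open>\<epsilon> \<le> 1 / \<beta>\<close>, to which \<open>sum_powr_chain_bound\<close> applies.\<close>

lemma whitney_chain_weight_bound:
  fixes \<Omega> :: "'a::euclidean_space set"
  assumes \<Omega>: "open \<Omega>" "bounded \<Omega>" and \<beta>: "1 \<le> \<beta>" and pos: "0 < lam" "0 < K"
    and k: "1 - real DIM('a) - 1 / \<beta> < k"
  obtains A where "0 \<le> A"
    "\<And>M y m T z. whitney_chain \<Omega> \<beta> lam K M y m T z \<Longrightarrow>
       (\<integral>\<^sup>+x\<in>(\<Union>i\<le>m. whitney_ball \<Omega> (z i)). ennreal (bdist \<Omega> x powr k) \<partial>lborel) \<le> ennreal A"
proof -
  define n where "n = real DIM('a)"
  have n: "1 \<le> n" by (simp add: n_def DIM_positive Suc_leI)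
  obtain D where D: "1 \<le> D" "\<And>x. x \<in> \<Omega> \<Longrightarrow> bdist \<Omega> x \<le> D"
    using bdist_le_bound[OF \<Omega>] by blast
  define \<epsilon> where "\<epsilon> = min (k + n - 1 + 1 / \<beta>) (1 / \<beta>)"
  have \<epsilon>: "0 < \<epsilon>" "\<epsilon> \<le> 1 / \<beta>" using k \<beta> by (auto simp: \<epsilon>_def n_def)
  define \<eta> where "\<eta> = 1 - 1 / \<beta> + \<epsilon>"
  have \<eta>: "0 \<le> \<eta>" "\<eta> \<le> 1" "\<eta> - n \<le> k"
    using \<beta> \<epsilon> by (auto simp: \<eta>_def \<epsilon>_def)
  define c where "c = D powr (k - (\<eta> - n)) * 2 powr (n - \<eta>) * unit_ball_vol n"
  have c: "0 \<le> c" using n by (simp add: c_def)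
  \<comment> \<open>The summand \<open>D powr \<eta>\<close> is for the last ball, which is not tied to a time
    increment.\<close>
  define S where "S = 8 * K * (8 / 9 * lam) powr (\<epsilon> - 1 / \<beta>) / (\<epsilon> * \<beta>) + D powr \<eta>"
  have S: "0 \<le> S" using pos \<epsilon> \<beta> by (simp add: S_def)
  show thesis
  proof (rule that[of "c * S"])
    show "0 \<le> c * S" using c S by simp
    fix M y m T z assume chain: "whitney_chain \<Omega> \<beta> lam K M y m T z"
    define d where "d i = bdist \<Omega> (z i)" for i
    have z\<Omega>: "z i \<in> \<Omega>" if "i \<le> Suc m" for i using chain that by (auto simp: whitney_chain_def)
    have d: "0 < d i" "d i \<le> D" if "i \<le> Suc m" for i
      using bdist_pos[OF \<Omega> z\<Omega>[OF that]] D(2)[OF z\<Omega>[OF that]] by (auto simp: d_def)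
    have "(\<Sum>i<m. d i powr (1 - 1 / \<beta> + \<epsilon>)) \<le> 8 * K * (8 / 9 * lam) powr (\<epsilon> - 1 / \<beta>) / (\<epsilon> * \<beta>)"
    proof (rule sum_powr_chain_bound[OF \<beta> \<epsilon>])
      fix i assume i: "i < m"
      have "lam * T (Suc i) powr \<beta> \<le> d (Suc i)"
        using chain i by (auto simp: whitney_chain_def d_def)
      also have "\<dots> \<le> 9 / 8 * d i"
        unfolding d_def using chain i by (intro bdist_ball_bounds) (auto simp: whitney_chain_def)
      finally show "8 / 9 * lam * T (Suc i) powr \<beta> \<le> d i" by simp
      have "d i / 8 \<le> K * (T (Suc i) - T i)" using chain i by (auto simp: whitney_chain_def d_def)
      then show "d i \<le> 8 * K * (T (Suc i) - T i)" by simp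
    qed (use chain d pos in \<open>auto simp: whitney_chain_def\<close>)
    moreover have "d m powr \<eta> \<le> D powr \<eta>" using d[of m] \<eta> by (intro powr_mono2) auto
    ultimately have sum: "(\<Sum>i\<le>m. d i powr \<eta>) \<le> S"
      unfolding lessThan_Suc_atMost[symmetric] by (simp add: S_def \<eta>_def)
    have ball: "(\<integral>\<^sup>+x\<in>whitney_ball \<Omega> (z i). ennreal (bdist \<Omega> x powr k) \<partial>lborel) \<le> ennreal (c * d i powr \<eta>)"
      if i: "i \<le> m" for i
    proof -
      let ?B = "whitney_ball \<Omega> (z i)"
      define e where "e = D powr (k - (\<eta> - n)) * (2 powr (n - \<eta>) * d i powr (\<eta> - n))"
      have pt: "bdist \<Omega> x powr k \<le> e" if x: "x \<in> ?B" for x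
      proof -
        have b: "7 / 8 * d i \<le> bdist \<Omega> x"
          using x unfolding d_def by (intro bdist_ball_bounds) auto
        then have dx: "0 < bdist \<Omega> x" "d i / 2 \<le> bdist \<Omega> x" using d(1)[of i] i by auto
        have "x \<in> \<Omega>"
          using x ball_bdist_subset[OF z\<Omega>[of i]] d(1)[of i] i by (auto simp: d_def subset_iff)
        then have le: "bdist \<Omega> x \<le> D" by (rule D(2))
        have "bdist \<Omega> x powr k = bdist \<Omega> x powr (k - (\<eta> - n)) * bdist \<Omega> x powr (\<eta> - n)"
          by (simp flip: powr_add)
        also have "\<dots> \<le> D powr (k - (\<eta> - n)) * (d i / 2) powr (\<eta> - n)"
          using dx le \<eta> n d(1)[of i] i by (intro mult_mono powr_mono2 powr_mono2') auto
        also have "(d i / 2) powr (\<eta> - n) = 2 powr (n - \<eta>) * d i powr (\<eta> - n)"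
          using powr_minus_divide[of 2 "n - \<eta>"] by (simp add: powr_divide)
        finally show ?thesis by (simp add: e_def)
      qed
      have "(\<integral>\<^sup>+x\<in>?B. ennreal (bdist \<Omega> x powr k) \<partial>lborel) \<le> (\<integral>\<^sup>+x. ennreal e * indicator ?B x \<partial>lborel)"
        using pt by (intro nn_integral_mono) (auto simp: indicator_def ennreal_leI)
      also have "\<dots> = ennreal e * emeasure lborel ?B"
        by (rule nn_integral_cmult_indicator) simp
      also have "\<dots> = ennreal (e * (unit_ball_vol n * (d i / 8) ^ DIM('a)))"
        using d(1)[of i] i by (simp add: emeasure_ball n_def d_def ennreal_mult e_def)
      also have "\<dots> \<le> ennreal (e * (unit_ball_vol n * d i powr n))"
      proof (intro ennreal_leI mult_left_mono)
        have "(d i / 8) ^ DIM('a) \<le> d i ^ DIM('a)"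
          using d(1)[of i] i by (intro power_mono) auto
        then show "(d i / 8) ^ DIM('a) \<le> d i powr n"
          using d(1)[of i] i by (simp add: n_def powr_realpow)
      qed (auto simp: e_def n_def)
      also have "e * (unit_ball_vol n * d i powr n) = c * (d i powr (\<eta> - n) * d i powr n)"
        by (simp add: e_def c_def)
      also have "\<dots> = c * d i powr \<eta>" by (simp flip: powr_add)
      finally show ?thesis .
    qed
    have "(\<integral>\<^sup>+x\<in>(\<Union>i\<le>m. whitney_ball \<Omega> (z i)). ennreal (bdist \<Omega> x powr k) \<partial>lborel)
      \<le> (\<integral>\<^sup>+x. (\<Sum>i\<le>m. ennreal (bdist \<Omega> x powr k) * indicator (whitney_ball \<Omega> (z i)) x) \<partial>lborel)"
    proof (intro nn_integral_mono)
      fix x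
      show "ennreal (bdist \<Omega> x powr k) * indicator (\<Union>i\<le>m. whitney_ball \<Omega> (z i)) x
        \<le> (\<Sum>i\<le>m. ennreal (bdist \<Omega> x powr k) * indicator (whitney_ball \<Omega> (z i)) x)"
      proof (cases "\<exists>i\<le>m. x \<in> whitney_ball \<Omega> (z i)")
        case True
        then obtain i where i: "i \<le> m" "x \<in> whitney_ball \<Omega> (z i)" by blast
        then show ?thesis
          using member_le_sum[of i "{..m}" "\<lambda>i. ennreal (bdist \<Omega> x powr k) * indicator (whitney_ball \<Omega> (z i)) x"]
          by (auto simp: indicator_def)
      qed (auto simp: indicator_def)
    qed
    also have "\<dots> = (\<Sum>i\<le>m. \<integral>\<^sup>+x\<in>whitney_ball \<Omega> (z i). ennreal (bdist \<Omega> x powr k) \<partial>lborel)"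
      by (intro nn_integral_sum borel_measurable_times_ennreal borel_measurable_indicator) auto
    also have "\<dots> \<le> (\<Sum>i\<le>m. ennreal (c * d i powr \<eta>))"
      by (intro sum_mono ball) auto
    also have "\<dots> = ennreal (c * (\<Sum>i\<le>m. d i powr \<eta>))"
      using c by (simp add: sum_distrib_left)
    also have "\<dots> \<le> ennreal (c * S)"
      using c sum by (intro ennreal_leI mult_left_mono)
    finally show "(\<integral>\<^sup>+x\<in>(\<Union>i\<le>m. whitney_ball \<Omega> (z i)). ennreal (bdist \<Omega> x powr k) \<partial>lborel) \<le> ennreal (c * S)" .
  qed
qed

text \<open>The chain reaches \<open>z i\<close> at time \<open>T i\<close>, and \<open>lam * T i powr \<beta> \<le> d(z i)\<close> bounds this time by a multiple of
\<open>d(x) powr (1 / \<beta>)\<close>; the radius of the ball is absorbed because \<open>d\<close> is bounded and \<open>1 / \<beta> \<le> 1\<close>.\<close>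

lemma whitney_chain_region:
  fixes \<Omega> :: "'a::euclidean_space set"
  assumes \<Omega>: "open \<Omega>" "bounded \<Omega>" and \<beta>: "1 \<le> \<beta>" and pos: "0 < lam" "0 < K"
  obtains C2 where "0 < C2"
    "\<And>M y m T z i x. whitney_chain \<Omega> \<beta> lam K M y m T z \<Longrightarrow> i \<le> m \<Longrightarrow> x \<in> whitney_ball \<Omega> (z i) \<Longrightarrow>
       x \<in> \<Omega> \<and> norm (x - y) < C2 * bdist \<Omega> x powr (1 / \<beta>)"
proof -
  obtain D where D: "1 \<le> D" "\<And>x. x \<in> \<Omega> \<Longrightarrow> bdist \<Omega> x \<le> D"
    using bdist_le_bound[OF \<Omega>] by blast
  define C2 where "C2 = K * (2 / lam) powr (1 / \<beta>) + D powr (1 - 1 / \<beta>)"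
  show thesis
  proof (rule that[of C2])
    show "0 < C2" using pos D by (auto simp: C2_def intro!: add_pos_pos)
    fix M y m T z i x
    assume chain: "whitney_chain \<Omega> \<beta> lam K M y m T z" and i: "i \<le> m" and x: "x \<in> whitney_ball \<Omega> (z i)"
    have "z i \<in> \<Omega>" using chain i by (auto simp: whitney_chain_def)
    have dz: "0 < bdist \<Omega> (z i)" by (rule bdist_pos[OF \<Omega> \<open>z i \<in> \<Omega>\<close>])
    have x\<Omega>: "x \<in> \<Omega>"
      using x ball_bdist_subset[OF \<open>z i \<in> \<Omega>\<close>] dz by (auto simp: subset_iff)
    define d where "d = bdist \<Omega> x"
    have "7 / 8 * bdist \<Omega> (z i) \<le> d" using x unfolding d_def by (intro bdist_ball_bounds) auto
    then have dzi: "bdist \<Omega> (z i) \<le> 2 * d" "0 < d" using dz by auto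
    have T: "0 \<le> T i" "lam * T i powr \<beta> \<le> 2 * d" "dist y (z i) \<le> K * T i"
      using chain i dzi by (auto simp: whitney_chain_def intro: order_trans)
    have "T i = (T i powr \<beta>) powr (1 / \<beta>)" using T \<beta> by (simp add: powr_powr)
    also have "\<dots> \<le> (2 / lam * d) powr (1 / \<beta>)"
      using T pos \<beta> by (intro powr_mono2) (auto simp: field_simps)
    also have "\<dots> = (2 / lam) powr (1 / \<beta>) * d powr (1 / \<beta>)"
      by (rule powr_mult)
    finally have "K * T i \<le> K * (2 / lam) powr (1 / \<beta>) * d powr (1 / \<beta>)"
      using pos by simp
    moreover have "d \<le> D powr (1 - 1 / \<beta>) * d powr (1 / \<beta>)"
    proof -
      have "d = d powr (1 - 1 / \<beta>) * d powr (1 / \<beta>)" using dzi by (simp flip: powr_add)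
      also have "\<dots> \<le> D powr (1 - 1 / \<beta>) * d powr (1 / \<beta>)"
        using dzi D(2)[OF x\<Omega>] \<beta> by (intro mult_right_mono powr_mono2) (auto simp: d_def)
      finally show ?thesis .
    qed
    moreover have "dist x y < d + K * T i"
      using dist_triangle[of x y "z i"] x T(3) dzi by (auto simp: dist_commute)
    ultimately show "x \<in> \<Omega> \<and> norm (x - y) < C2 * bdist \<Omega> x powr (1 / \<beta>)"
      using x\<Omega> by (simp add: C2_def d_def dist_norm algebra_simps)
  qed
qed

section \<open>The pointwise bound\<close>

text \<open>The exponents \<open>a\<close>, \<open>b\<close>, \<open>q\<close> enter the bound only through the exponent \<open>e = b - (n + a) * p / (\<beta> * q)\<close> of the
weight. The constant mean is the mean over the ball around \<open>0\<close>, at which all chains end.\<close>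

lemma john_domain_pointwise_bound:
  fixes \<Omega> :: "'a::euclidean_space set" and \<beta> n :: real
  defines "n \<equiv> real DIM('a)"
  assumes john: "john_domain \<beta> \<Omega>" and \<beta>: "1 \<le> \<beta>"
  shows "\<exists>C>0. \<exists>C1>0. \<exists>C2>0. \<forall>p s e :: real.
    1 \<le> p \<and> 0 < s \<and> s < 1 \<and> (p > 1 \<longrightarrow> e < s * p - p + 1 - n + (p - 1) / \<beta>) \<and> (p = 1 \<longrightarrow> e = s - n) \<longrightarrow>
    (\<exists>C'>0. (p = 1 \<or> \<beta> = 1 \<longrightarrow> C' = C) \<and>
      (\<forall>f. continuous_on \<Omega> f \<longrightarrow> (\<exists>fbar. \<forall>y\<in>\<Omega>.
        ennreal \<bar>f y - fbar\<bar> \<le>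
          ennreal C * (\<integral>\<^sup>+ x \<in> {x\<in>\<Omega>. norm (x - y) < C1 * bdist \<Omega> x}.
              frac_h \<Omega> s p f x / ennreal (norm (x - y) powr (n - s)) \<partial>lborel) +
          ennreal C' * enn_powr (\<integral>\<^sup>+ x \<in> {x\<in>\<Omega>. norm (x - y) < C2 * bdist \<Omega> x powr (1 / \<beta>)}.
              enn_powr (frac_h \<Omega> s p f x) p * ennreal (bdist \<Omega> x powr e) \<partial>lborel) (1 / p))))"
proof -
  have \<Omega>: "open \<Omega>" "bounded \<Omega>" using john by (auto simp: john_domain_def)
  have [measurable]: "\<Omega> \<in> sets borel" using \<Omega> by simp
  have n: "1 \<le> n" by (simp add: n_def DIM_positive Suc_leI)
  obtain lam K M where pos: "0 < lam" "0 < K" "0 < M"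
    and chains: "\<And>y. y \<in> \<Omega> \<Longrightarrow> \<exists>m T z. whitney_chain \<Omega> \<beta> lam K M y m T z"
    using john_domain_chains[OF john \<beta>] by metis
  obtain C2 where C2: "0 < C2" and region: "\<And>M y m T z i x. whitney_chain \<Omega> \<beta> lam K M y m T z \<Longrightarrow> i \<le> m \<Longrightarrow>
      x \<in> whitney_ball \<Omega> (z i) \<Longrightarrow> x \<in> \<Omega> \<and> norm (x - y) < C2 * bdist \<Omega> x powr (1 / \<beta>)"
    using whitney_chain_region[OF \<Omega> \<beta> pos(1,2)] by metis
  \<comment> \<open>\<open>C1 \<ge> 1\<close> makes the first term cover the annuli around \<open>y\<close>, and \<open>C1
    \<ge> C2\<close> the chain if \<open>\<beta> = 1\<close>.\<close>
  define C1 where "C1 = max 1 C2"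
  define C3 where "C3 = C1 powr n"
  define Cl where "Cl = 2 * step_const TYPE('a)"
  define Cc where "Cc = 3 ^ DIM('a) * step_const TYPE('a) * M"
  define C where "C = Cl + Cc * C3 + Cc"
  have constants_pos: "1 \<le> C1" "0 < C3" "0 < Cl" "0 < Cc"
    using pos step_const_pos[of "TYPE('a)"] by (auto simp: C1_def C3_def Cl_def Cc_def)
  then have "0 < Cc * C3" by simp
  then have C: "0 < C" "Cl \<le> C" "Cl + Cc * C3 \<le> C" "Cc \<le> C" using constants_pos unfolding C_def by linarith+
  show ?thesis
  proof (rule exI[of _ C], rule conjI[OF C(1)], rule exI[of _ C1], rule conjI, use constants_pos in simp,
      rule exI[of _ C2], rule conjI[OF C2], intro allI impI, goal_cases)
    case (1 p s e)
    then have p: "1 \<le> p" and s: "0 < s" "s < 1"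
      and e: "p > 1 \<Longrightarrow> e < s * p - p + 1 - n + (p - 1) / \<beta>" "p = 1 \<Longrightarrow> e = s - n"
      by auto
    define I1 where "I1 f y = (\<integral>\<^sup>+ x \<in> {x\<in>\<Omega>. norm (x - y) < C1 * bdist \<Omega> x}.
              frac_h \<Omega> s p f x / ennreal (norm (x - y) powr (n - s)) \<partial>lborel)" for f y
    define I2 where "I2 f y = (\<integral>\<^sup>+ x \<in> {x\<in>\<Omega>. norm (x - y) < C2 * bdist \<Omega> x powr (1 / \<beta>)}.
              enn_powr (frac_h \<Omega> s p f x) p * ennreal (bdist \<Omega> x powr e) \<partial>lborel)" for f y
    define J where "J f m z = (\<integral>\<^sup>+x\<in>(\<Union>i\<le>m. whitney_ball \<Omega> (z i)).
           frac_h \<Omega> s p f x * ennreal (bdist \<Omega> x powr (s - n)) \<partial>lborel)" for f and m :: nat and z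
    have main: "\<exists>m T z. whitney_chain \<Omega> \<beta> lam K M y m T z \<and>
        ennreal \<bar>f y - mean_on (whitney_ball \<Omega> 0) f\<bar> \<le> ennreal Cl * I1 f y + ennreal Cc * J f m z"
      if f: "continuous_on \<Omega> f" and y: "y \<in> \<Omega>" for f y
    proof -
      obtain m T z where chain: "whitney_chain \<Omega> \<beta> lam K M y m T z" using chains[OF y] by blast
      have "ennreal \<bar>f y - mean_on (whitney_ball \<Omega> 0) f\<bar>
          \<le> ennreal (\<bar>f y - mean_on (whitney_ball \<Omega> y) f\<bar> + \<bar>mean_on (whitney_ball \<Omega> y) f - mean_on (whitney_ball \<Omega> 0) f\<bar>)"
        by (intro ennreal_leI) auto
      also have "\<dots> = ennreal \<bar>f y - mean_on (whitney_ball \<Omega> y) f\<bar>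
          + ennreal \<bar>mean_on (whitney_ball \<Omega> y) f - mean_on (whitney_ball \<Omega> 0) f\<bar>"
        by simp
      also have "\<dots> \<le> ennreal Cl * I1 f y + ennreal Cc * J f m z"
      proof (rule add_mono)
        have "ennreal \<bar>f y - mean_on (whitney_ball \<Omega> y) f\<bar> \<le> ennreal Cl *
            (\<integral>\<^sup>+x\<in>whitney_ball \<Omega> y. frac_h \<Omega> s p f x / ennreal (norm (x - y) powr (n - s)) \<partial>lborel)"
          using pointwise_minus_mean_on_ball[OF f \<Omega> y p s] by (simp add: Cl_def n_def)
        also have "\<dots> \<le> ennreal Cl * I1 f y"
          unfolding I1_def
        proof (rule mult_left_mono, rule nn_integral_mono)
          fix x
          have "x \<in> \<Omega> \<and> norm (x - y) < C1 * bdist \<Omega> x" if x: "x \<in> whitney_ball \<Omega> y"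
          proof -
            have dy: "0 < bdist \<Omega> y" by (rule bdist_pos[OF \<Omega> y])
            then have "x \<in> \<Omega>" using x ball_bdist_subset[OF y] by (auto simp: subset_iff)
            moreover have "7 / 8 * bdist \<Omega> y \<le> bdist \<Omega> x" using x by (intro bdist_ball_bounds) auto
            then have "norm (x - y) < 1 * bdist \<Omega> x"
              using x dy by (auto simp: dist_norm norm_minus_commute)
            then have "norm (x - y) < C1 * bdist \<Omega> x"
              using mult_right_mono[OF constants_pos(1) infdist_nonneg[of x "frontier \<Omega>"]] by linarith
            ultimately show ?thesis by blast
          qed
          then show "frac_h \<Omega> s p f x / ennreal (norm (x - y) powr (n - s)) * indicator (whitney_ball \<Omega> y) x
             \<le> frac_h \<Omega> s p f x / ennreal (norm (x - y) powr (n - s)) * indicator {x\<in>\<Omega>. norm (x - y) < C1 * bdist \<Omega> x} x"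
            by (auto simp: indicator_def)
        qed simp
        finally show "ennreal \<bar>f y - mean_on (whitney_ball \<Omega> y) f\<bar> \<le> ennreal Cl * I1 f y" .
        show "ennreal \<bar>mean_on (whitney_ball \<Omega> y) f - mean_on (whitney_ball \<Omega> 0) f\<bar> \<le> ennreal Cc * J f m z"
          using whitney_chain_mean_difference[OF f \<Omega> p s less_imp_le[OF pos(3)] chain]
          by (simp add: Cc_def J_def n_def)
      qed
      finally show ?thesis using chain by blast
    qed
    have measure_h: "frac_h \<Omega> s p f \<in> borel_measurable borel" if "continuous_on \<Omega> f" for f
      using cball_half_bdist_subset \<Omega> that by (intro borel_measurable_frac_h) auto
    have "\<exists>C'>0. (p = 1 \<or> \<beta> = 1 \<longrightarrow> C' = C) \<and> (\<forall>f. continuous_on \<Omega> f \<longrightarrow> (\<forall>y\<in>\<Omega>.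
        ennreal \<bar>f y - mean_on (whitney_ball \<Omega> 0) f\<bar> \<le> ennreal C * I1 f y + ennreal C' * enn_powr (I2 f y) (1 / p)))"
    proof (cases "\<beta> = 1")
      case True
      have "ennreal \<bar>f y - mean_on (whitney_ball \<Omega> 0) f\<bar> \<le> ennreal C * I1 f y + ennreal C * enn_powr (I2 f y) (1 / p)"
        if f: "continuous_on \<Omega> f" and y: "y \<in> \<Omega>" for f y
      proof -
        note measure_h[OF f, measurable]
        obtain m T z where chain: "whitney_chain \<Omega> \<beta> lam K M y m T z"
          and le: "ennreal \<bar>f y - mean_on (whitney_ball \<Omega> 0) f\<bar> \<le> ennreal Cl * I1 f y + ennreal Cc * J f m z"
          using main[OF f y] by blast
        have "J f m z \<le> (\<integral>\<^sup>+ x. ennreal C3 * (frac_h \<Omega> s p f x / ennreal (norm (x - y) powr (n - s))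
             * indicator {x\<in>\<Omega>. norm (x - y) < C1 * bdist \<Omega> x} x) \<partial>lborel)"
          unfolding J_def
        proof (intro nn_integral_mono)
          fix x
          show "frac_h \<Omega> s p f x * ennreal (bdist \<Omega> x powr (s - n)) * indicator (\<Union>i\<le>m. whitney_ball \<Omega> (z i)) x
            \<le> ennreal C3 * (frac_h \<Omega> s p f x / ennreal (norm (x - y) powr (n - s))
               * indicator {x\<in>\<Omega>. norm (x - y) < C1 * bdist \<Omega> x} x)"
          proof (cases "x \<in> (\<Union>i\<le>m. whitney_ball \<Omega> (z i))")
            case x: True
            then have x\<Omega>: "x \<in> \<Omega>" and near: "norm (x - y) < C2 * bdist \<Omega> x"
              using region[OF chain] \<open>\<beta> = 1\<close> bdist_pos[OF \<Omega>, of x] by (fastforce)+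
            have dx: "0 < bdist \<Omega> x" by (rule bdist_pos[OF \<Omega> x\<Omega>])
            have "C2 * bdist \<Omega> x \<le> C1 * bdist \<Omega> x" using dx by (simp add: C1_def)
            then have near1: "norm (x - y) < C1 * bdist \<Omega> x" using near by linarith
            have "ennreal (bdist \<Omega> x powr (s - n)) \<le> ennreal C3 * inverse (ennreal (norm (x - y) powr (n - s)))"
            proof (cases "x = y")
              case True
              \<comment> \<open>The kernel is \<open>\<infinity>\<close> at \<open>x = y\<close>.\<close>
              then show ?thesis using constants_pos by (simp add: ennreal_mult_top)
            next
              case False
              then have nz: "0 < norm (x - y)" by simp
              have "bdist \<Omega> x powr (s - n) \<le> (norm (x - y) / C1) powr (s - n)"
                using near1 nz constants_pos dx s n by (intro powr_mono2') (auto simp: field_simps)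
              also have "\<dots> = C1 powr (n - s) * inverse (norm (x - y) powr (n - s))"
                using powr_minus_divide[of C1 "n - s"] powr_minus[of "norm (x - y)" "n - s"] by (simp add: powr_divide)
              also have "\<dots> \<le> C3 * inverse (norm (x - y) powr (n - s))"
                unfolding C3_def using constants_pos s by (intro mult_right_mono powr_mono) auto
              finally show ?thesis
                using nz constants_pos by (simp add: inverse_ennreal ennreal_leI flip: ennreal_mult)
            qed
            then have "frac_h \<Omega> s p f x * ennreal (bdist \<Omega> x powr (s - n))
              \<le> frac_h \<Omega> s p f x * (ennreal C3 * inverse (ennreal (norm (x - y) powr (n - s))))"
              by (rule mult_left_mono) simp
            then show ?thesis using x x\<Omega> near1 by (simp add: divide_ennreal_def mult_ac)
          qed simp
        qed
        also have "\<dots> = ennreal C3 * I1 f y"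
          unfolding I1_def by (intro nn_integral_cmult) measurable
        finally have "ennreal Cc * J f m z \<le> ennreal Cc * (ennreal C3 * I1 f y)"
          by (rule mult_left_mono) simp
        with le have "ennreal \<bar>f y - mean_on (whitney_ball \<Omega> 0) f\<bar>
            \<le> ennreal Cl * I1 f y + ennreal Cc * (ennreal C3 * I1 f y)"
          by (meson add_left_mono order_trans)
        also have "\<dots> = ennreal (Cl + Cc * C3) * I1 f y"
          using constants_pos by (simp add: ennreal_mult distrib_right mult.assoc)
        also have "\<dots> \<le> ennreal C * I1 f y"
          using C by (intro mult_right_mono ennreal_leI) auto
        finally show ?thesis by (simp add: add_increasing2)
      qed
      then show ?thesis using C(1) by blast
    next
      case \<beta>1: False
      show ?thesis
      proof (cases "p = 1")
        case True
        have "ennreal \<bar>f y - mean_on (whitney_ball \<Omega> 0) f\<bar> \<le> ennreal C * I1 f y + ennreal C * enn_powr (I2 f y) (1 / p)"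
          if f: "continuous_on \<Omega> f" and y: "y \<in> \<Omega>" for f y
        proof -
          obtain m T z where chain: "whitney_chain \<Omega> \<beta> lam K M y m T z"
            and le: "ennreal \<bar>f y - mean_on (whitney_ball \<Omega> 0) f\<bar> \<le> ennreal Cl * I1 f y + ennreal Cc * J f m z"
            using main[OF f y] by blast
          have "J f m z \<le> I2 f y"
            unfolding J_def I2_def
          proof (intro nn_integral_mono)
            fix x
            show "frac_h \<Omega> s p f x * ennreal (bdist \<Omega> x powr (s - n)) * indicator (\<Union>i\<le>m. whitney_ball \<Omega> (z i)) x
              \<le> enn_powr (frac_h \<Omega> s p f x) p * ennreal (bdist \<Omega> x powr e)
                 * indicator {x\<in>\<Omega>. norm (x - y) < C2 * bdist \<Omega> x powr (1 / \<beta>)} x"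
              using region[OF chain] e(2) True by (auto simp: enn_powr_one indicator_def)
          qed
          then have "ennreal Cl * I1 f y + ennreal Cc * J f m z \<le> ennreal C * I1 f y + ennreal C * I2 f y"
            using C by (intro add_mono mult_mono ennreal_leI) auto
          then show ?thesis using le True by (simp add: enn_powr_one)
        qed
        then show ?thesis using C(1) by blast
      next
        case False
        then have p1: "1 < p" using p by simp
        \<comment> \<open>In \<open>weak_holder\<close>, \<open>d powr (s - n)\<close> is split as \<open>d powr (e / p)\<close>,
          which belongs to the second term, times \<open>(d powr k) powr (1 - 1 / p)\<close>.\<close>
        define k where "k = (s - n - e / p) * p / (p - 1)"
        have k_exp: "e / p + k * (1 - 1 / p) = s - n"
          using p1 by (simp add: k_def divide_simps)
        have "1 - n - 1 / \<beta> < k"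
        proof -
          have "(1 - n - 1 / \<beta>) * (p - 1) < (s - n) * p - e"
            using e(1)[OF p1] by (simp add: algebra_simps diff_divide_distrib)
          also have "(s - n) * p - e = (s - n - e / p) * p" using p1 by (simp add: algebra_simps)
          finally show ?thesis using p1 by (simp add: k_def pos_less_divide_eq)
        qed
        then obtain A where A: "0 \<le> A" "\<And>M y m T z. whitney_chain \<Omega> \<beta> lam K M y m T z \<Longrightarrow>
            (\<integral>\<^sup>+x\<in>(\<Union>i\<le>m. whitney_ball \<Omega> (z i)). ennreal (bdist \<Omega> x powr k) \<partial>lborel) \<le> ennreal A"
          using whitney_chain_weight_bound[OF \<Omega> \<beta> pos(1,2), of k] unfolding n_def by blast
        define C' where "C' = Cc * (A + 1)"
        have "ennreal \<bar>f y - mean_on (whitney_ball \<Omega> 0) f\<bar> \<le> ennreal C * I1 f y + ennreal C' * enn_powr (I2 f y) (1 / p)"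
          if f: "continuous_on \<Omega> f" and y: "y \<in> \<Omega>" for f y
        proof -
          note measure_h[OF f, measurable]
          obtain m T z where chain: "whitney_chain \<Omega> \<beta> lam K M y m T z"
            and le: "ennreal \<bar>f y - mean_on (whitney_ball \<Omega> 0) f\<bar> \<le> ennreal Cl * I1 f y + ennreal Cc * J f m z"
            using main[OF f y] by blast
          define E where "E = (\<Union>i\<le>m. whitney_ball \<Omega> (z i))"
          have [measurable]: "E \<in> sets borel" by (auto simp: E_def)
          have E: "x \<in> \<Omega>" "norm (x - y) < C2 * bdist \<Omega> x powr (1 / \<beta>)" "0 < bdist \<Omega> x" if "x \<in> E" for x
            using region[OF chain] that bdist_pos[OF \<Omega>, of x] by (auto simp: E_def)
          define X where "X x = frac_h \<Omega> s p f x * ennreal (bdist \<Omega> x powr (e / p)) * indicator E x" for x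
          define w where "w x = bdist \<Omega> x powr k * indicator E x" for x
          have [measurable]: "X \<in> borel_measurable lborel" "w \<in> borel_measurable lborel"
            unfolding X_def[abs_def] w_def[abs_def] by measurable
          have "J f m z = (\<integral>\<^sup>+x. X x * ennreal (w x powr (1 - 1 / p)) \<partial>lborel)"
            unfolding J_def E_def[symmetric]
          proof (intro nn_integral_cong)
            fix x
            have "bdist \<Omega> x powr (e / p) * (bdist \<Omega> x powr k) powr (1 - 1 / p) = bdist \<Omega> x powr (s - n)"
              unfolding powr_powr powr_add[symmetric] k_exp ..
            then show "frac_h \<Omega> s p f x * ennreal (bdist \<Omega> x powr (s - n)) * indicator E x
                = X x * ennreal (w x powr (1 - 1 / p))"
              by (auto simp: X_def w_def indicator_def mult.assoc simp flip: ennreal_mult)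
          qed
          also have "\<dots> \<le> ennreal (A + 1) * enn_powr (\<integral>\<^sup>+x. enn_powr (X x) p \<partial>lborel) (1 / p)"
          proof (rule weak_holder)
            have "(\<integral>\<^sup>+x. ennreal (w x) \<partial>lborel) = (\<integral>\<^sup>+x\<in>E. ennreal (bdist \<Omega> x powr k) \<partial>lborel)"
              by (intro nn_integral_cong) (auto simp: w_def indicator_def)
            then show "(\<integral>\<^sup>+x. ennreal (w x) \<partial>lborel) \<le> ennreal A"
              using A(2)[OF chain] by (simp add: E_def)
          qed (use A p in \<open>auto simp: w_def\<close>)
          also have "\<dots> \<le> ennreal (A + 1) * enn_powr (I2 f y) (1 / p)"
            unfolding I2_def
          proof (intro mult_left_mono enn_powr_mono nn_integral_mono)
            fix x
            show "enn_powr (X x) p \<le> enn_powr (frac_h \<Omega> s p f x) p * ennreal (bdist \<Omega> x powr e)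
               * indicator {x\<in>\<Omega>. norm (x - y) < C2 * bdist \<Omega> x powr (1 / \<beta>)} x"
            proof (cases "x \<in> E")
              case True
              have "0 < bdist \<Omega> x powr (e / p)" using E(3)[OF True] by simp
              then have "enn_powr (X x) p = enn_powr (frac_h \<Omega> s p f x) p * ennreal ((bdist \<Omega> x powr (e / p)) powr p)"
                using True by (simp only: X_def enn_powr_mult_ennreal indicator_simps mult_1_right)
              then show ?thesis using E True p1 by (simp add: powr_powr)
            next
              case False
              then show ?thesis using p by (simp add: X_def enn_powr_def)
            qed
          qed (use p in auto)
          finally have "ennreal Cl * I1 f y + ennreal Cc * J f m z
              \<le> ennreal C * I1 f y + ennreal Cc * (ennreal (A + 1) * enn_powr (I2 f y) (1 / p))"
            using C by (intro add_mono mult_mono ennreal_leI) auto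
          then show ?thesis
            using le constants_pos A(1) by (simp add: C'_def ennreal_mult mult.assoc)
        qed
        moreover have "0 < C'" using constants_pos A(1) by (simp add: C'_def)
        ultimately show ?thesis using False \<beta>1 by blast
      qed
    qed
    then show ?case unfolding I1_def I2_def by blast
  qed
qed

theorem proposition4p1:
  fixes \<Omega> :: "(real ^ 'n) set" and \<beta> n :: real
  defines "n \<equiv> real CARD('n)"
  assumes "CARD('n) \<ge> 2" and "\<beta> \<ge> 1" and "john_domain \<beta> \<Omega>"
  shows "\<exists>C>0. \<exists>C1>0. \<exists>C2>0. \<forall>p q s a b :: real.
    1 \<le> p \<and> 0 < q \<and> 0 < s \<and> s < 1 \<and> 0 \<le> a \<and>
    (p > 1 \<longrightarrow> b < s * p - p + 1 - n + (p - 1) / \<beta> + p * (n + a) / (q * \<beta>)) \<and>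
    (p = 1 \<longrightarrow> b = s - n + (n + a) / (\<beta> * q)) \<longrightarrow>
    (\<exists>C'>0. (p = 1 \<or> \<beta> = 1 \<longrightarrow> C' = C) \<and>
      (\<forall>f. smooth_on \<Omega> f \<longrightarrow> (\<exists>fbar. \<forall>y\<in>\<Omega>.
        ennreal \<bar>f y - fbar\<bar> \<le>
          ennreal C * (\<integral>\<^sup>+ x \<in> {x\<in>\<Omega>. norm (x - y) < C1 * bdist \<Omega> x}.
              frac_h \<Omega> s p f x / ennreal (norm (x - y) powr (n - s)) \<partial>lborel) +
          ennreal C' * enn_powr (\<integral>\<^sup>+ x \<in> {x\<in>\<Omega>. norm (x - y) < C2 * bdist \<Omega> x powr (1 / \<beta>)}.
              enn_powr (frac_h \<Omega> s p f x) p *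
                ennreal (bdist \<Omega> x powr (b - (n + a) * p / (\<beta> * q))) \<partial>lborel) (1 / p))))"
proof -
  have dim: "real DIM(real ^ 'n) = n" by (simp add: n_def)
  obtain C C1 C2 where C: "0 < C" "0 < C1" "0 < C2" and bound: "\<forall>p s e :: real.
    1 \<le> p \<and> 0 < s \<and> s < 1 \<and> (p > 1 \<longrightarrow> e < s * p - p + 1 - n + (p - 1) / \<beta>) \<and> (p = 1 \<longrightarrow> e = s - n) \<longrightarrow>
    (\<exists>C'>0. (p = 1 \<or> \<beta> = 1 \<longrightarrow> C' = C) \<and>
      (\<forall>f. continuous_on \<Omega> f \<longrightarrow> (\<exists>fbar. \<forall>y\<in>\<Omega>.
        ennreal \<bar>f y - fbar\<bar> \<le>
          ennreal C * (\<integral>\<^sup>+ x \<in> {x\<in>\<Omega>. norm (x - y) < C1 * bdist \<Omega> x}.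
              frac_h \<Omega> s p f x / ennreal (norm (x - y) powr (n - s)) \<partial>lborel) +
          ennreal C' * enn_powr (\<integral>\<^sup>+ x \<in> {x\<in>\<Omega>. norm (x - y) < C2 * bdist \<Omega> x powr (1 / \<beta>)}.
              enn_powr (frac_h \<Omega> s p f x) p * ennreal (bdist \<Omega> x powr e) \<partial>lborel) (1 / p))))"
    using john_domain_pointwise_bound[OF assms(4,3)] unfolding dim by blast
  have smooth: "continuous_on \<Omega> f" if "smooth_on \<Omega> f" for f
    using that unfolding smooth_on_def by (metis Ck_on.simps(1))
  show ?thesis
  proof (rule exI[of _ C], rule conjI[OF C(1)], rule exI[of _ C1], rule conjI[OF C(2)],
      rule exI[of _ C2], rule conjI[OF C(3)], intro allI impI, goal_cases)
    case (1 p q s a b)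
    have "p * (n + a) / (q * \<beta>) = (n + a) * p / (\<beta> * q)" by (simp add: mult.commute)
    with 1 have "1 \<le> p \<and> 0 < s \<and> s < 1 \<and>
        (p > 1 \<longrightarrow> b - (n + a) * p / (\<beta> * q) < s * p - p + 1 - n + (p - 1) / \<beta>) \<and>
        (p = 1 \<longrightarrow> b - (n + a) * p / (\<beta> * q) = s - n)"
      by auto
    from bound[THEN spec, THEN spec, THEN spec, THEN mp, OF this] show ?case
      by (elim ex_forward conj_forward)
         (assumption | (intro allI impI, drule spec, erule mp, erule smooth))+
  qed
qed

end
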